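(* Let $R$ be a commutative Noetherian local ring and let $M$ be a finitely generated eventually two-periodic $R$-module. Let $s$ be the smallest non-negative integer such that $N:=\Omega^s_R M$ is two-periodic. If $\operatorname{Ext}^i_R(N,N\oplus R)=0$ for all $i\ge 1$, then $\operatorname{pd}_R M\le s$.
   Context: For a finitely generated module $M$ over a local ring, $\Omega^i_R M$ denotes the $i$-th syzygy of $M$ in its minimal free resolution (with $\Omega^0_R M=M$). $M$ is two-periodic if $M\cong\Omega^2_R M$, and eventually two-periodic if $\Omega^s_R M$ is two-periodic for some $s\ge 0$. $\operatorname{pd}_R$ denotes projective dimension. *)

theory Defs
  imports
    "HOL-Algebra.Ring_Divisibility"
    "HOL-Algebra.Module"
    "HOL-Library.Extended_Nat"
begin

text \<open>
  The module record of HOL-Algebra extends the ring record. The locale \<open>module\<close> uses only the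
  fields \<open>carrier\<close>, \<open>zero\<close>, \<open>add\<close> and \<open>smult\<close>; the fields \<open>mult\<close> and \<open>one\<close> of the modules
  constructed below carry no meaning.
\<close>

definition local_ring :: "('a, 'r) ring_scheme \<Rightarrow> bool" where
  "local_ring R \<longleftrightarrow> cring R \<and> (\<exists>!I. maximalideal I R)"

definition max_ideal :: "('a, 'r) ring_scheme \<Rightarrow> 'a set" where
  "max_ideal R = (THE I. maximalideal I R)"

definition finitely_generated ::
    "('a, 'r) ring_scheme \<Rightarrow> ('a, 'b, 'm) module_scheme \<Rightarrow> bool" where
  "finitely_generated R M \<longleftrightarrow>
     (\<exists>A. finite A \<and> A \<subseteq> carrier M \<and> (\<forall>H. submodule H R M \<and> A \<subseteq> H \<longrightarrow> H = carrier M))"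

definition mod_hom ::
    "('a, 'r) ring_scheme \<Rightarrow> ('a, 'b, 'm) module_scheme \<Rightarrow> ('a, 'c, 'n) module_scheme
      \<Rightarrow> ('b \<Rightarrow> 'c) set" where
  "mod_hom R M N =
     {f \<in> carrier M \<rightarrow> carrier N.
        (\<forall>x\<in>carrier M. \<forall>y\<in>carrier M. f (x \<oplus>\<^bsub>M\<^esub> y) = f x \<oplus>\<^bsub>N\<^esub> f y) \<and>
        (\<forall>a\<in>carrier R. \<forall>x\<in>carrier M. f (a \<odot>\<^bsub>M\<^esub> x) = a \<odot>\<^bsub>N\<^esub> f x)}"

definition mod_iso ::
    "('a, 'r) ring_scheme \<Rightarrow> ('a, 'b, 'm) module_scheme \<Rightarrow> ('a, 'c, 'n) module_scheme \<Rightarrow> bool" where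
  "mod_iso R M N \<longleftrightarrow> (\<exists>f\<in>mod_hom R M N. bij_betw f (carrier M) (carrier N))"

definition zero_module :: "('a, 'b, 'm) module_scheme \<Rightarrow> bool" where
  "zero_module M \<longleftrightarrow> carrier M = {\<zero>\<^bsub>M\<^esub>}"


subsection \<open>Constructions of modules\<close>

definition regular_module :: "('a, 'r) ring_scheme \<Rightarrow> ('a, 'a) module" where
  "regular_module R =
     \<lparr>carrier = carrier R, mult = mult R, one = one R, zero = zero R, add = add R,
      smult = mult R\<rparr>"

definition direct_sum ::
    "('a, 'b, 'm) module_scheme \<Rightarrow> ('a, 'c, 'n) module_scheme \<Rightarrow> ('a, 'b \<times> 'c) module" where
  "direct_sum M N =
     \<lparr>carrier = carrier M \<times> carrier N, mult = undefined, one = undefined,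
      zero = (\<zero>\<^bsub>M\<^esub>, \<zero>\<^bsub>N\<^esub>),
      add = (\<lambda>(x, y) (x', y'). (x \<oplus>\<^bsub>M\<^esub> x', y \<oplus>\<^bsub>N\<^esub> y')),
      smult = (\<lambda>a (x, y). (a \<odot>\<^bsub>M\<^esub> x, a \<odot>\<^bsub>N\<^esub> y))\<rparr>"

text \<open>The free module on an index set, i.e. the finitely supported families.\<close>

definition free_module :: "('a, 'r) ring_scheme \<Rightarrow> 'i set \<Rightarrow> ('a, 'i \<Rightarrow> 'a) module" where
  "free_module R I =
     \<lparr>carrier = {f \<in> I \<rightarrow>\<^sub>E carrier R. finite {i \<in> I. f i \<noteq> \<zero>\<^bsub>R\<^esub>}},
      mult = undefined, one = undefined,
      zero = (\<lambda>i\<in>I. \<zero>\<^bsub>R\<^esub>),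
      add = (\<lambda>f g. \<lambda>i\<in>I. f i \<oplus>\<^bsub>R\<^esub> g i),
      smult = (\<lambda>a f. \<lambda>i\<in>I. a \<otimes>\<^bsub>R\<^esub> f i)\<rparr>"

definition hom_module ::
    "('a, 'r) ring_scheme \<Rightarrow> ('a, 'b, 'm) module_scheme \<Rightarrow> ('a, 'c, 'n) module_scheme
      \<Rightarrow> ('a, 'b \<Rightarrow> 'c) module" where
  "hom_module R M N =
     \<lparr>carrier = mod_hom R M N \<inter> extensional (carrier M), mult = undefined, one = undefined,
      zero = (\<lambda>x\<in>carrier M. \<zero>\<^bsub>N\<^esub>),
      add = (\<lambda>f g. \<lambda>x\<in>carrier M. f x \<oplus>\<^bsub>N\<^esub> g x),
      smult = (\<lambda>a f. \<lambda>x\<in>carrier M. a \<odot>\<^bsub>N\<^esub> f x)\<rparr>"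

definition quot_module :: "('a, 'b, 'm) module_scheme \<Rightarrow> 'b set \<Rightarrow> ('a, 'b set) module" where
  "quot_module M H =
     \<lparr>carrier = a_rcosets\<^bsub>M\<^esub> H, mult = undefined, one = undefined,
      zero = H, add = set_add M,
      smult = (\<lambda>a X. \<Union>x\<in>X. H +>\<^bsub>M\<^esub> (a \<odot>\<^bsub>M\<^esub> x))\<rparr>"

text \<open>Transport of the module structure along a map that is injective on the carrier.\<close>

definition copy_module :: "('b \<Rightarrow> 'c) \<Rightarrow> ('a, 'b, 'm) module_scheme \<Rightarrow> ('a, 'c) module" where
  "copy_module h M =
     (let k = inv_into (carrier M) h in
      \<lparr>carrier = h ` carrier M, mult = undefined, one = undefined,
       zero = h \<zero>\<^bsub>M\<^esub>,
       add = (\<lambda>x y. h (k x \<oplus>\<^bsub>M\<^esub> k y)),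
       smult = (\<lambda>a x. h (a \<odot>\<^bsub>M\<^esub> k x))\<rparr>)"


subsection \<open>Resolutions and projective dimension\<close>

text \<open>
  A module is projective iff it is a direct summand of a free module. Every module is a quotient
  of the free module on its own elements, so index sets in the type of elements suffice.
\<close>

definition projective :: "('a, 'r) ring_scheme \<Rightarrow> ('a, 'p, 'm) module_scheme \<Rightarrow> bool" where
  "projective R P \<longleftrightarrow> module R P \<and>
     (\<exists>(I :: 'p set) u v. u \<in> mod_hom R P (free_module R I) \<and> v \<in> mod_hom R (free_module R I) P \<and>
        (\<forall>x\<in>carrier P. v (u x) = x))"

text \<open>
  Exactness of \<open>\<dots> \<rightarrow> P 2 \<rightarrow> P 1 \<rightarrow> P 0 \<rightarrow> M \<rightarrow> 0\<close>, where \<open>d i\<close> is the map from \<open>P (i + 1)\<close>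
  to \<open>P i\<close> and \<open>e\<close> is the augmentation.
\<close>

definition resolution ::
    "('a, 'r) ring_scheme \<Rightarrow> (nat \<Rightarrow> ('a, 'p) module) \<Rightarrow> (nat \<Rightarrow> 'p \<Rightarrow> 'p) \<Rightarrow> ('p \<Rightarrow> 'b)
      \<Rightarrow> ('a, 'b, 'm) module_scheme \<Rightarrow> bool" where
  "resolution R P d e M \<longleftrightarrow>
     (\<forall>i. module R (P i)) \<and>
     (\<forall>i. d i \<in> mod_hom R (P (Suc i)) (P i)) \<and>
     e \<in> mod_hom R (P 0) M \<and>
     e ` carrier (P 0) = carrier M \<and>
     d 0 ` carrier (P (Suc 0)) = a_kernel (P 0) M e \<and>
     (\<forall>i. d (Suc i) ` carrier (P (Suc (Suc i))) = a_kernel (P (Suc i)) (P i) (d i))"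

definition projective_resolution ::
    "('a, 'r) ring_scheme \<Rightarrow> (nat \<Rightarrow> ('a, 'p) module) \<Rightarrow> (nat \<Rightarrow> 'p \<Rightarrow> 'p) \<Rightarrow> ('p \<Rightarrow> 'b)
      \<Rightarrow> ('a, 'b, 'm) module_scheme \<Rightarrow> bool" where
  "projective_resolution R P d e M \<longleftrightarrow> resolution R P d e M \<and> (\<forall>i. projective R (P i))"

text \<open>
  In the notions below that refer to projective resolutions, the resolving modules have their
  elements in the type \<open>nat \<Rightarrow> 'a\<close>, which contains all \<open>R\<^sup>n\<close> and their submodules. Over
  a Noetherian ring this is enough room for finitely generated modules: they have resolutions by
  modules \<open>R\<^sup>n\<close>, and if the projective dimension is at most \<open>n\<close>, then the \<open>n\<close>-th syzygy in such a
  resolution is projective and truncation there gives a resolution of length \<open>n\<close>. The notions are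
  meant for such modules only.

  The projective dimension of the zero module is 0 here.
\<close>

definition proj_dim :: "('a, 'r) ring_scheme \<Rightarrow> ('a, 'b, 'm) module_scheme \<Rightarrow> enat" where
  "proj_dim R M =
     Inf {enat n |n. \<exists>(P :: nat \<Rightarrow> ('a, nat \<Rightarrow> 'a) module) d e.
            projective_resolution R P d e M \<and> (\<forall>i>n. zero_module (P i))}"


subsection \<open>Ext\<close>

definition chosen_proj_res ::
    "('a, 'r) ring_scheme \<Rightarrow> ('a, 'b, 'm) module_scheme
      \<Rightarrow> (nat \<Rightarrow> ('a, nat \<Rightarrow> 'a) module) \<times> (nat \<Rightarrow> (nat \<Rightarrow> 'a) \<Rightarrow> nat \<Rightarrow> 'a)" where
  "chosen_proj_res R M = (SOME (P, d). \<exists>e. projective_resolution R P d e M)"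

text \<open>Cocycles, coboundaries and cohomology of the complex \<open>Hom(P, N)\<close>.\<close>

definition hom_cocycles ::
    "('a, 'r) ring_scheme \<Rightarrow> (nat \<Rightarrow> ('a, 'p) module) \<Rightarrow> (nat \<Rightarrow> 'p \<Rightarrow> 'p)
      \<Rightarrow> ('a, 'c, 'n) module_scheme \<Rightarrow> nat \<Rightarrow> ('p \<Rightarrow> 'c) set" where
  "hom_cocycles R P d N i =
     {f \<in> carrier (hom_module R (P i) N). \<forall>x\<in>carrier (P (Suc i)). f (d i x) = \<zero>\<^bsub>N\<^esub>}"

definition hom_coboundaries ::
    "('a, 'r) ring_scheme \<Rightarrow> (nat \<Rightarrow> ('a, 'p) module) \<Rightarrow> (nat \<Rightarrow> 'p \<Rightarrow> 'p)
      \<Rightarrow> ('a, 'c, 'n) module_scheme \<Rightarrow> nat \<Rightarrow> ('p \<Rightarrow> 'c) set" where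
  "hom_coboundaries R P d N i =
     (case i of
        0 \<Rightarrow> {\<zero>\<^bsub>hom_module R (P 0) N\<^esub>}
      | Suc j \<Rightarrow> (\<lambda>f. compose (carrier (P i)) f (d j)) ` carrier (hom_module R (P j) N))"

definition hom_cohomology ::
    "('a, 'r) ring_scheme \<Rightarrow> (nat \<Rightarrow> ('a, 'p) module) \<Rightarrow> (nat \<Rightarrow> 'p \<Rightarrow> 'p)
      \<Rightarrow> ('a, 'c, 'n) module_scheme \<Rightarrow> nat \<Rightarrow> ('a, ('p \<Rightarrow> 'c) set) module" where
  "hom_cohomology R P d N i =
     quot_module ((hom_module R (P i) N)\<lparr>carrier := hom_cocycles R P d N i\<rparr>)
       (hom_coboundaries R P d N i)"

definition Ext ::
    "('a, 'r) ring_scheme \<Rightarrow> nat \<Rightarrow> ('a, 'b, 'm) module_scheme \<Rightarrow> ('a, 'c, 'n) module_scheme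
      \<Rightarrow> ('a, ((nat \<Rightarrow> 'a) \<Rightarrow> 'c) set) module" where
  "Ext R i M N = (case chosen_proj_res R M of (P, d) \<Rightarrow> hom_cohomology R P d N i)"


subsection \<open>Minimal free resolutions and syzygies\<close>

text \<open>
  A resolution by \<open>R\<^sup>n\<close> with \<open>n = b 0, b 1, \<dots>\<close> such that the image of each \<open>d i\<close> lies in the
  maximal ideal times \<open>R\<^sup>n\<close> with \<open>n = b i\<close>, i.e. consists of vectors with entries in the maximal
  ideal.
\<close>

definition minimal_free_resolution ::
    "('a, 'r) ring_scheme \<Rightarrow> (nat \<Rightarrow> nat) \<Rightarrow> (nat \<Rightarrow> (nat \<Rightarrow> 'a) \<Rightarrow> nat \<Rightarrow> 'a)
      \<Rightarrow> ((nat \<Rightarrow> 'a) \<Rightarrow> 'b) \<Rightarrow> ('a, 'b, 'm) module_scheme \<Rightarrow> bool" where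
  "minimal_free_resolution R b d e M \<longleftrightarrow>
     resolution R (\<lambda>i. free_module R {..<b i}) d e M \<and>
     (\<forall>i. \<forall>x\<in>carrier (free_module R {..<b (Suc i)}). \<forall>j<b i. d i x j \<in> max_ideal R)"

text \<open>
  Over a Noetherian local ring, every finitely generated module has a minimal free resolution,
  unique up to isomorphism.
\<close>

definition chosen_min_res ::
    "('a, 'r) ring_scheme \<Rightarrow> ('a, 'b, 'm) module_scheme
      \<Rightarrow> (nat \<Rightarrow> nat) \<times> (nat \<Rightarrow> (nat \<Rightarrow> 'a) \<Rightarrow> nat \<Rightarrow> 'a)" where
  "chosen_min_res R M = (SOME (b, d). \<exists>e. minimal_free_resolution R b d e M)"

text \<open>
  The zeroth syzygy is the module itself and the \<open>(k + 1)\<close>-st one is the image of \<open>d k\<close> in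
  \<open>R\<^sup>n\<close>, \<open>n = b k\<close>. The sum type gives all syzygies of a module the same type: \<open>Inl\<close> and
  \<open>Inr\<close> merely rename elements.
\<close>

definition syzygy ::
    "('a, 'r) ring_scheme \<Rightarrow> nat \<Rightarrow> ('a, 'b, 'm) module_scheme
      \<Rightarrow> ('a, 'b + (nat \<Rightarrow> 'a)) module" where
  "syzygy R i M =
     (case i of
        0 \<Rightarrow> copy_module Inl M
      | Suc k \<Rightarrow> (case chosen_min_res R M of (b, d) \<Rightarrow>
          copy_module Inr
            ((free_module R {..<b k})
               \<lparr>carrier := d k ` carrier (free_module R {..<b (Suc k)})\<rparr>)))"

definition two_periodic ::
    "('a, 'r) ring_scheme \<Rightarrow> ('a, 'b, 'm) module_scheme \<Rightarrow> bool" where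
  "two_periodic R M \<longleftrightarrow> mod_iso R M (syzygy R 2 M)"

definition eventually_two_periodic ::
    "('a, 'r) ring_scheme \<Rightarrow> ('a, 'b, 'm) module_scheme \<Rightarrow> bool" where
  "eventually_two_periodic R M \<longleftrightarrow> (\<exists>s. two_periodic R (syzygy R s M))"

end

theory Submission
  imports Defs
begin

text \<open>
  It suffices to show that \<open>N\<close> is a direct summand of a finite free module: then the minimal
  resolution of \<open>M\<close> can be cut off at its \<open>s\<close>-th syzygy. Let \<open>F\<close> be the minimal
  free resolution of \<open>N\<close>. The sequence \<open>0 \<rightarrow> \<Omega>\<^sup>2N \<rightarrow> F\<^sub>1 \<rightarrow> \<Omega>N \<rightarrow> 0\<close> traps \<open>Ext\<^sup>1(N, \<Omega>N)\<close>
  between \<open>Ext\<^sup>1(N, F\<^sub>1) = 0\<close> and \<open>Ext\<^sup>2(N, \<Omega>\<^sup>2N) \<cong> Ext\<^sup>2(N, N) = 0\<close>, so \<open>0 \<rightarrow> \<Omega>N \<rightarrow> F\<^sub>0 \<rightarrow> N \<rightarrow> 0\<close>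
  splits. This is carried out on cocycles: only \<open>Ext\<^sup>1\<close> and \<open>Ext\<^sup>2\<close> enter, and no long exact
  sequence is needed.
\<close>

section \<open>Module homomorphisms and submodules\<close>

text \<open>\<open>Ext\<close> and \<open>syzygy\<close> rest on two unrelated choices for
  \<open>N\<close>: a projective resolution \<open>P\<close> and a minimal free resolution
  \<open>F\<close>. Both choices are empty until existence is proved, and this is where the ring
  enters: kernels of maps between finite free modules stay finitely generated, and least generating
  sets give minimal covers. Independence of Ext from the resolution is bypassed by lifting the
  identity of \<open>N\<close> to just two maps, \<open>\<alpha>0 : P 0 -> F 0\<close> and
  \<open>\<alpha>1 : P 1 -> F 1\<close>.

  The obstruction to splitting is the cocycle \<open>\<alpha>0 (d 0 x)\<close>, which the connecting
  map sends to \<open>\<alpha>1 (d 1 x)\<close>, with values in the second syzygy. Periodicity moves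
  it into \<open>N\<close>, where Ext^2 makes it the coboundary of some \<open>g\<close>. Correcting
  \<open>\<alpha>1\<close> by \<open>g\<close> leaves a cocycle with values in \<open>F 1\<close>,
  that is, finitely many cocycles with values in R, and Ext^1 extends them to a map \<open>h\<close>
  on \<open>P 0\<close>. Correcting \<open>\<alpha>0\<close> by \<open>h\<close> gives a map that
  kills the image of \<open>d 0\<close> and descends to a section of
  \<open>F 0 -> N\<close>.\<close>

lemma mod_homI:
  assumes "\<And>x. x \<in> carrier M \<Longrightarrow> f x \<in> carrier N"
    and "\<And>x y. x \<in> carrier M \<Longrightarrow> y \<in> carrier M \<Longrightarrow> f (x \<oplus>\<^bsub>M\<^esub> y) = f x \<oplus>\<^bsub>N\<^esub> f y"
    and "\<And>a x. a \<in> carrier R \<Longrightarrow> x \<in> carrier M \<Longrightarrow> f (a \<odot>\<^bsub>M\<^esub> x) = a \<odot>\<^bsub>N\<^esub> f x"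
  shows "f \<in> mod_hom R M N"
  using assms by (auto simp: mod_hom_def)

lemma mod_homD:
  assumes "f \<in> mod_hom R M N"
  shows "x \<in> carrier M \<Longrightarrow> f x \<in> carrier N"
    and "x \<in> carrier M \<Longrightarrow> y \<in> carrier M \<Longrightarrow> f (x \<oplus>\<^bsub>M\<^esub> y) = f x \<oplus>\<^bsub>N\<^esub> f y"
    and "a \<in> carrier R \<Longrightarrow> x \<in> carrier M \<Longrightarrow> f (a \<odot>\<^bsub>M\<^esub> x) = a \<odot>\<^bsub>N\<^esub> f x"
  using assms by (auto simp: mod_hom_def)

lemma mod_hom_zero:
  assumes "module R M" "module R N" "f \<in> mod_hom R M N"
  shows "f \<zero>\<^bsub>M\<^esub> = \<zero>\<^bsub>N\<^esub>"
proof -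
  interpret M: module R M by fact
  interpret N: module R N by fact
  have "f \<zero>\<^bsub>M\<^esub> = f (\<zero>\<^bsub>R\<^esub> \<odot>\<^bsub>M\<^esub> \<zero>\<^bsub>M\<^esub>)" by simp
  also have "\<dots> = \<zero>\<^bsub>R\<^esub> \<odot>\<^bsub>N\<^esub> f \<zero>\<^bsub>M\<^esub>" by (rule mod_homD(3)[OF assms(3)]) auto
  also have "\<dots> = \<zero>\<^bsub>N\<^esub>" using mod_homD(1)[OF assms(3)] by simp
  finally show ?thesis .
qed

lemma mod_hom_minus:
  assumes "module R M" "module R N" "f \<in> mod_hom R M N" "x \<in> carrier M"
  shows "f (\<ominus>\<^bsub>M\<^esub> x) = \<ominus>\<^bsub>N\<^esub> f x"
proof -
  interpret M: module R M by fact
  interpret N: module R N by fact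
  have "f (\<ominus>\<^bsub>M\<^esub> x) \<oplus>\<^bsub>N\<^esub> f x = f (\<ominus>\<^bsub>M\<^esub> x \<oplus>\<^bsub>M\<^esub> x)"
    using assms by (simp add: mod_homD[OF assms(3)])
  also have "\<dots> = \<zero>\<^bsub>N\<^esub>" using assms mod_hom_zero[OF assms(1-3)] by (simp add: M.M.l_neg)
  finally show ?thesis using assms
    by (intro N.M.minus_equality[symmetric]) (auto simp: mod_homD(1)[OF assms(3)])
qed

lemma mod_hom_diff:
  assumes "module R M" "module R N" "f \<in> mod_hom R M N" "x \<in> carrier M" "y \<in> carrier M"
  shows "f (x \<ominus>\<^bsub>M\<^esub> y) = f x \<ominus>\<^bsub>N\<^esub> f y"
proof -
  interpret M: module R M by fact
  interpret N: module R N by fact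
  show ?thesis using assms mod_hom_minus[OF assms(1-3,5)]
    by (simp add: a_minus_def mod_homD[OF assms(3)])
qed

lemma module_diff_eq_zero_iff:
  assumes "module R M" "x \<in> carrier M" "y \<in> carrier M"
  shows "x \<ominus>\<^bsub>M\<^esub> y = \<zero>\<^bsub>M\<^esub> \<longleftrightarrow> x = y"
proof -
  interpret M: module R M by fact
  show ?thesis
    using M.M.r_neg M.M.minus_equality[of x "\<ominus>\<^bsub>M\<^esub> y"] assms(2,3) by (auto simp: a_minus_def)
qed

lemma mod_hom_comp:
  assumes "f \<in> mod_hom R M N" "g \<in> mod_hom R N K"
  shows "(\<lambda>x. g (f x)) \<in> mod_hom R M K"
  by (intro mod_homI) (simp_all add: mod_homD[OF assms(1)] mod_homD[OF assms(2)])

lemma mod_hom_subtract: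
  assumes "module R M" "module R N" "f \<in> mod_hom R M N" "g \<in> mod_hom R M N"
  shows "(\<lambda>x. f x \<ominus>\<^bsub>N\<^esub> g x) \<in> mod_hom R M N"
proof -
  interpret M: module R M by fact
  interpret N: module R N by fact
  note D = mod_homD[OF assms(3)] mod_homD[OF assms(4)]
  show ?thesis
  proof (intro mod_homI)
    fix x y assume "x \<in> carrier M" "y \<in> carrier M"
    then show "f (x \<oplus>\<^bsub>M\<^esub> y) \<ominus>\<^bsub>N\<^esub> g (x \<oplus>\<^bsub>M\<^esub> y) = (f x \<ominus>\<^bsub>N\<^esub> g x) \<oplus>\<^bsub>N\<^esub> (f y \<ominus>\<^bsub>N\<^esub> g y)"
      by (simp add: D a_minus_def N.M.minus_add N.M.a_ac)
  next
    fix a x assume "a \<in> carrier R" "x \<in> carrier M"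
    then show "f (a \<odot>\<^bsub>M\<^esub> x) \<ominus>\<^bsub>N\<^esub> g (a \<odot>\<^bsub>M\<^esub> x) = a \<odot>\<^bsub>N\<^esub> (f x \<ominus>\<^bsub>N\<^esub> g x)"
      by (simp add: D a_minus_def N.smult_r_distr N.smult_r_minus)
  qed (simp add: D)
qed

lemma mod_hom_kernel_submodule:
  assumes "module R M" "module R N" "f \<in> mod_hom R M N"
  shows "submodule (a_kernel M N f) R M"
proof -
  interpret M: module R M by fact
  interpret N: module R N by fact
  show ?thesis
    by (intro M.submoduleI)
      (auto simp: a_kernel_def' mod_homD[OF assms(3)] mod_hom_zero[OF assms] mod_hom_minus[OF assms])
qed

lemma submodule_zero_mem:
  assumes "submodule H R M"
  shows "\<zero>\<^bsub>M\<^esub> \<in> H"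
  using assms subgroup.one_closed[of H "add_monoid M"] by (simp add: submodule_def)

lemma mod_hom_image_submodule:
  assumes "module R M" "module R N" "f \<in> mod_hom R M N" "submodule H R M"
  shows "submodule (f ` H) R N"
proof -
  interpret M: module R M by fact
  interpret N: module R N by fact
  note H = M.submoduleE[OF assms(4)]
  have 0: "\<zero>\<^bsub>M\<^esub> \<in> H" by (rule submodule_zero_mem[OF assms(4)])
  show ?thesis
  proof (intro N.submoduleI)
    show "f ` H \<subseteq> carrier N" using H(1) mod_homD(1)[OF assms(3)] by auto
    show "\<zero>\<^bsub>N\<^esub> \<in> f ` H" using 0 mod_hom_zero[OF assms(1-3)] by (metis imageI)
    show "\<ominus>\<^bsub>N\<^esub> a \<in> f ` H" if "a \<in> f ` H" for a
      using that H(1,3) mod_hom_minus[OF assms(1-3)] by (metis (no_types, lifting) imageE imageI subsetD)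
    show "a \<oplus>\<^bsub>N\<^esub> b \<in> f ` H" if "a \<in> f ` H" "b \<in> f ` H" for a b
      using that H(1,5) mod_homD(2)[OF assms(3)] by (smt (verit) imageE imageI subsetD)
    show "a \<odot>\<^bsub>N\<^esub> x \<in> f ` H" if "a \<in> carrier R" "x \<in> f ` H" for a x
      using that H(1,4) mod_homD(3)[OF assms(3)] by (smt (verit) imageE imageI subsetD)
  qed
qed

lemma mod_hom_vimage_submodule:
  assumes "module R M" "module R N" "f \<in> mod_hom R M N" "submodule H R N"
  shows "submodule {x \<in> carrier M. f x \<in> H} R M"
proof -
  interpret M: module R M by fact
  interpret N: module R N by fact
  note H = N.submoduleE[OF assms(4)]
  have 0: "\<zero>\<^bsub>N\<^esub> \<in> H" by (rule submodule_zero_mem[OF assms(4)])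
  show ?thesis
    by (intro M.submoduleI)
      (auto simp: mod_homD[OF assms(3)] mod_hom_zero[OF assms(1-3)] mod_hom_minus[OF assms(1-3)] 0 H)
qed

lemma submodule_module:
  assumes "module R M" "submodule H R M"
  shows "module R (M\<lparr>carrier := H\<rparr>)"
  using submodule.submodule_is_module assms by blast

text \<open>Submodules are records \<open>M\<lparr>carrier := H\<rparr>\<close> that share the
  operations of \<open>M\<close>. Restricting or extending a homomorphism therefore keeps the
  function and changes only the carriers on which it is checked.\<close>

lemma mod_hom_restrict_source:
  assumes "f \<in> mod_hom R M N" "H \<subseteq> carrier M"
  shows "f \<in> mod_hom R (M\<lparr>carrier := H\<rparr>) N"
  using assms by (auto simp: mod_hom_def subset_iff)

lemma mod_hom_restrict_target:
  assumes "f \<in> mod_hom R M N" "f ` carrier M \<subseteq> H"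
  shows "f \<in> mod_hom R M (N\<lparr>carrier := H\<rparr>)"
  using assms by (auto simp: mod_hom_def)

lemma mod_hom_extend_target:
  assumes "f \<in> mod_hom R M (N\<lparr>carrier := H\<rparr>)" "H \<subseteq> carrier N"
  shows "f \<in> mod_hom R M N"
  using assms by (auto simp: mod_hom_def)

lemma mod_hom_inv_into:
  assumes "module R M" "f \<in> mod_hom R M N" "bij_betw f (carrier M) (carrier N)"
  shows "inv_into (carrier M) f \<in> mod_hom R N M"
proof -
  interpret M: module R M by fact
  note inj = bij_betw_imp_inj_on[OF assms(3)] and im = bij_betw_imp_surj_on[OF assms(3)]
  note D = mod_homD[OF assms(2)]
  let ?k = "inv_into (carrier M) f"
  have k: "?k x \<in> carrier M" "f (?k x) = x" if "x \<in> carrier N" for x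
    using that im by (auto simp: inv_into_into f_inv_into_f)
  show ?thesis
  proof (intro mod_homI)
    fix x y assume xy: "x \<in> carrier N" "y \<in> carrier N"
    have "f (?k x \<oplus>\<^bsub>M\<^esub> ?k y) = x \<oplus>\<^bsub>N\<^esub> y" using xy by (simp add: D k)
    then show "?k (x \<oplus>\<^bsub>N\<^esub> y) = ?k x \<oplus>\<^bsub>M\<^esub> ?k y"
      using inv_into_f_f[OF inj, of "?k x \<oplus>\<^bsub>M\<^esub> ?k y"] k xy by simp
  next
    fix a x assume xy: "a \<in> carrier R" "x \<in> carrier N"
    have "f (a \<odot>\<^bsub>M\<^esub> ?k x) = a \<odot>\<^bsub>N\<^esub> x" using xy by (simp add: D k)
    then show "?k (a \<odot>\<^bsub>N\<^esub> x) = a \<odot>\<^bsub>M\<^esub> ?k x"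
      using inv_into_f_f[OF inj, of "a \<odot>\<^bsub>M\<^esub> ?k x"] k xy by simp
  qed (simp add: k)
qed

section \<open>Transport along surjections and renamings\<close>

text \<open>The module axioms can be checked on preimages. Nothing is known about \<open>N\<close>
  beforehand, so preservation of zero is a hypothesis here and not a consequence of linearity. This
  gives the module structure on \<open>copy_module\<close>.\<close>

lemma module_surj_image:
  fixes R :: "('a, 'r) ring_scheme"
  assumes "module R M" "g \<in> mod_hom R M N" "g ` carrier M = carrier N" "g \<zero>\<^bsub>M\<^esub> = \<zero>\<^bsub>N\<^esub>"
  shows "module R N"
proof -
  interpret M: module R M by fact
  note D = mod_homD[OF assms(2)]
  have ex: "\<exists>x\<in>carrier M. y = g x" if "y \<in> carrier N" for y using that assms(3) by auto
  have z: "\<zero>\<^bsub>N\<^esub> \<in> carrier N" using D(1)[of "\<zero>\<^bsub>M\<^esub>"] assms(4) by simp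
  show ?thesis
  proof (rule moduleI)
    show "cring R" by (rule M.R.is_cring)
    show "abelian_group N"
    proof (rule abelian_groupI)
      fix x y assume "x \<in> carrier N" "y \<in> carrier N"
      then obtain x' y' where "x' \<in> carrier M" "y' \<in> carrier M" "x = g x'" "y = g y'" by (meson ex)
      \<comment> \<open>Here and below, expressions in values of \<open>g\<close> are first folded
        into a single value of \<open>g\<close>; the axiom of \<open>M\<close> then applies under
        \<open>g\<close>.\<close>
      then show "x \<oplus>\<^bsub>N\<^esub> y \<in> carrier N" "x \<oplus>\<^bsub>N\<^esub> y = y \<oplus>\<^bsub>N\<^esub> x"
        by (simp_all add: D flip: D(2)) (simp_all add: D M.M.a_comm)
    next
      fix x y z assume "x \<in> carrier N" "y \<in> carrier N" "z \<in> carrier N"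
      then obtain x' y' z' where "x' \<in> carrier M" "y' \<in> carrier M" "x = g x'" "y = g y'"
          "z' \<in> carrier M" "z = g z'" by (meson ex)
      then show "x \<oplus>\<^bsub>N\<^esub> y \<oplus>\<^bsub>N\<^esub> z = x \<oplus>\<^bsub>N\<^esub> (y \<oplus>\<^bsub>N\<^esub> z)"
        by (simp flip: D(2)) (simp add: M.M.a_assoc)
    next
      fix x assume "x \<in> carrier N"
      then obtain x' where x': "x' \<in> carrier M" "x = g x'" by (meson ex)
      then show "\<zero>\<^bsub>N\<^esub> \<oplus>\<^bsub>N\<^esub> x = x" by (simp flip: D(2) assms(4))
      have "g (\<ominus>\<^bsub>M\<^esub> x') \<in> carrier N \<and> g (\<ominus>\<^bsub>M\<^esub> x') \<oplus>\<^bsub>N\<^esub> x = \<zero>\<^bsub>N\<^esub>"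
        using x' by (simp add: D(1) flip: D(2) assms(4)) (simp add: M.M.l_neg)
      then show "\<exists>y\<in>carrier N. y \<oplus>\<^bsub>N\<^esub> x = \<zero>\<^bsub>N\<^esub>" by blast
    qed (rule z)
  next
    fix a x y assume a: "a \<in> carrier R" and "x \<in> carrier N" "y \<in> carrier N"
    then obtain x' y' where "x' \<in> carrier M" "y' \<in> carrier M" "x = g x'" "y = g y'" by (meson ex)
    with a show "a \<odot>\<^bsub>N\<^esub> (x \<oplus>\<^bsub>N\<^esub> y) = a \<odot>\<^bsub>N\<^esub> x \<oplus>\<^bsub>N\<^esub> a \<odot>\<^bsub>N\<^esub> y"
      by (simp flip: D(2,3)) (simp add: M.smult_r_distr)
  next
    fix a b x assume a: "a \<in> carrier R" "b \<in> carrier R" and "x \<in> carrier N"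
    then obtain x' where "x' \<in> carrier M" "x = g x'" by (meson ex)
    with a show "a \<odot>\<^bsub>N\<^esub> x \<in> carrier N" "a \<otimes>\<^bsub>R\<^esub> b \<odot>\<^bsub>N\<^esub> x = a \<odot>\<^bsub>N\<^esub> (b \<odot>\<^bsub>N\<^esub> x)"
      "(a \<oplus>\<^bsub>R\<^esub> b) \<odot>\<^bsub>N\<^esub> x = a \<odot>\<^bsub>N\<^esub> x \<oplus>\<^bsub>N\<^esub> b \<odot>\<^bsub>N\<^esub> x"
      by (simp_all add: D(1) flip: D(2,3)) (simp_all add: M.smult_assoc1 M.smult_l_distr)
  next
    fix x assume "x \<in> carrier N"
    then obtain x' where "x' \<in> carrier M" "x = g x'" by (meson ex)
    then show "\<one>\<^bsub>R\<^esub> \<odot>\<^bsub>N\<^esub> x = x" by (simp flip: D(3))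
  qed
qed

text \<open>Generation is phrased through submodules that contain the generators, so pulling such a
  submodule back along \<open>f\<close> settles the claim without linear combinations.\<close>

lemma finitely_generated_image:
  assumes "module R M" "module R N" "f \<in> mod_hom R M N" "f ` carrier M = carrier N"
    and "finitely_generated R M"
  shows "finitely_generated R N"
proof -
  obtain A where A: "finite A" "A \<subseteq> carrier M"
    "\<And>H. submodule H R M \<Longrightarrow> A \<subseteq> H \<Longrightarrow> H = carrier M"
    using assms(5) unfolding finitely_generated_def by blast
  have "H = carrier N" if H: "submodule H R N" "f ` A \<subseteq> H" for H
  proof
    show "H \<subseteq> carrier N" by (rule module.submoduleE(1)[OF assms(2) H(1)])
    have "{x \<in> carrier M. f x \<in> H} = carrier M"
      using A(2) H(2) by (intro A(3) mod_hom_vimage_submodule[OF assms(1-3) H(1)]) auto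
    then show "carrier N \<subseteq> H" unfolding assms(4)[symmetric] by blast
  qed
  then show ?thesis using A assms(4) unfolding finitely_generated_def
    by (intro exI[of _ "f ` A"]) (use mod_homD(1)[OF assms(3)] in auto)
qed

lemma copy_module_hom:
  assumes "inj_on h (carrier M)"
  shows "h \<in> mod_hom R M (copy_module h M)"
  using assms by (auto simp: mod_hom_def copy_module_def Let_def)

lemma copy_module_carrier [simp]: "carrier (copy_module h M) = h ` carrier M"
  by (simp add: copy_module_def Let_def)

lemma copy_module_module:
  assumes "module R M" "inj_on h (carrier M)"
  shows "module R (copy_module h M)"
  using assms
  by (intro module_surj_image[OF assms(1) copy_module_hom[OF assms(2)]])
    (auto simp: copy_module_def Let_def)

lemma copy_module_bij:
  assumes "inj_on h (carrier M)"
  shows "bij_betw h (carrier M) (carrier (copy_module h M))"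
  using assms by (simp add: bij_betw_def)


section \<open>Free modules\<close>

lemma free_module_simps:
  "\<zero>\<^bsub>free_module R I\<^esub> = (\<lambda>i\<in>I. \<zero>\<^bsub>R\<^esub>)"
  "f \<oplus>\<^bsub>free_module R I\<^esub> g = (\<lambda>i\<in>I. f i \<oplus>\<^bsub>R\<^esub> g i)"
  "a \<odot>\<^bsub>free_module R I\<^esub> f = (\<lambda>i\<in>I. a \<otimes>\<^bsub>R\<^esub> f i)"
  by (simp_all add: free_module_def)

lemma free_module_carrierI:
  assumes "f \<in> extensional I" "\<And>i. i \<in> I \<Longrightarrow> f i \<in> carrier R" "finite {i \<in> I. f i \<noteq> \<zero>\<^bsub>R\<^esub>}"
  shows "f \<in> carrier (free_module R I)"
  using assms by (auto simp: free_module_def PiE_def)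

lemma free_module_carrierD:
  assumes "f \<in> carrier (free_module R I)"
  shows "f \<in> extensional I" "i \<in> I \<Longrightarrow> f i \<in> carrier R" "finite {i \<in> I. f i \<noteq> \<zero>\<^bsub>R\<^esub>}"
  using assms by (auto simp: free_module_def PiE_def)

lemma free_module_module:
  assumes "cring R"
  shows "module R (free_module R I)"
proof -
  interpret R: cring R by fact
  let ?F = "free_module R I"
  note D = free_module_carrierD[where R = R and I = I]
  show ?thesis
  proof (rule moduleI)
    show "cring R" by fact
    show "abelian_group ?F"
    proof (rule abelian_groupI)
      fix f g assume fg: "f \<in> carrier ?F" "g \<in> carrier ?F"
      show "f \<oplus>\<^bsub>?F\<^esub> g \<in> carrier ?F"
      proof (rule free_module_carrierI)
        show "finite {i \<in> I. (f \<oplus>\<^bsub>?F\<^esub> g) i \<noteq> \<zero>\<^bsub>R\<^esub>}"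
          by (rule finite_subset[of _ "{i \<in> I. f i \<noteq> \<zero>\<^bsub>R\<^esub>} \<union> {i \<in> I. g i \<noteq> \<zero>\<^bsub>R\<^esub>}"])
            (use fg D(3) in \<open>auto simp: free_module_simps\<close>)
      qed (use fg D(2) in \<open>auto simp: free_module_simps\<close>)
      show "f \<oplus>\<^bsub>?F\<^esub> g = g \<oplus>\<^bsub>?F\<^esub> f"
        using fg D(2) by (auto simp: free_module_simps fun_eq_iff R.a_comm restrict_def)
      fix h assume h: "h \<in> carrier ?F"
      show "f \<oplus>\<^bsub>?F\<^esub> g \<oplus>\<^bsub>?F\<^esub> h = f \<oplus>\<^bsub>?F\<^esub> (g \<oplus>\<^bsub>?F\<^esub> h)"
        using fg h D(2) by (auto simp: free_module_simps fun_eq_iff R.a_assoc restrict_def)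
    next
      show "\<zero>\<^bsub>?F\<^esub> \<in> carrier ?F"
        by (rule free_module_carrierI) (auto simp: free_module_simps)
    next
      fix f assume f: "f \<in> carrier ?F"
      show "\<zero>\<^bsub>?F\<^esub> \<oplus>\<^bsub>?F\<^esub> f = f"
        using f D(1,2)[OF f] by (auto simp: free_module_simps fun_eq_iff restrict_def extensional_def)
      have "(\<lambda>i\<in>I. \<ominus>\<^bsub>R\<^esub> f i) \<in> carrier ?F"
      proof (rule free_module_carrierI)
        show "finite {i \<in> I. (\<lambda>i\<in>I. \<ominus>\<^bsub>R\<^esub> f i) i \<noteq> \<zero>\<^bsub>R\<^esub>}"
          by (rule finite_subset[OF _ D(3)[OF f]]) auto
      qed (use D(2)[OF f] in auto)
      moreover have "(\<lambda>i\<in>I. \<ominus>\<^bsub>R\<^esub> f i) \<oplus>\<^bsub>?F\<^esub> f = \<zero>\<^bsub>?F\<^esub>"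
        using D(2)[OF f] by (auto simp: free_module_simps fun_eq_iff restrict_def R.l_neg)
      ultimately show "\<exists>g\<in>carrier ?F. g \<oplus>\<^bsub>?F\<^esub> f = \<zero>\<^bsub>?F\<^esub>" by blast
    qed
  next
    fix a f assume af: "a \<in> carrier R" "f \<in> carrier ?F"
    show "a \<odot>\<^bsub>?F\<^esub> f \<in> carrier ?F"
    proof (rule free_module_carrierI)
      show "finite {i \<in> I. (a \<odot>\<^bsub>?F\<^esub> f) i \<noteq> \<zero>\<^bsub>R\<^esub>}"
        by (rule finite_subset[OF _ D(3)[OF af(2)]]) (use af in \<open>auto simp: free_module_simps\<close>)
    qed (use af D(2) in \<open>auto simp: free_module_simps\<close>)
    fix b assume b: "b \<in> carrier R"
    show "(a \<oplus>\<^bsub>R\<^esub> b) \<odot>\<^bsub>?F\<^esub> f = a \<odot>\<^bsub>?F\<^esub> f \<oplus>\<^bsub>?F\<^esub> b \<odot>\<^bsub>?F\<^esub> f"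
      using af b D(2)[OF af(2)] by (auto simp: free_module_simps fun_eq_iff R.l_distr restrict_def)
    show "a \<otimes>\<^bsub>R\<^esub> b \<odot>\<^bsub>?F\<^esub> f = a \<odot>\<^bsub>?F\<^esub> (b \<odot>\<^bsub>?F\<^esub> f)"
      using af b D(2)[OF af(2)] by (auto simp: free_module_simps fun_eq_iff R.m_assoc restrict_def)
  next
    fix a f g assume af: "a \<in> carrier R" "f \<in> carrier ?F" "g \<in> carrier ?F"
    show "a \<odot>\<^bsub>?F\<^esub> (f \<oplus>\<^bsub>?F\<^esub> g) = a \<odot>\<^bsub>?F\<^esub> f \<oplus>\<^bsub>?F\<^esub> a \<odot>\<^bsub>?F\<^esub> g"
      using af D(2)[OF af(2)] D(2)[OF af(3)]
      by (auto simp: free_module_simps fun_eq_iff R.r_distr restrict_def)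
  next
    fix f assume f: "f \<in> carrier ?F"
    show "\<one>\<^bsub>R\<^esub> \<odot>\<^bsub>?F\<^esub> f = f"
      using f D(1,2)[OF f] by (auto simp: free_module_simps fun_eq_iff restrict_def extensional_def)
  qed
qed

section \<open>Unit vectors and maps out of free modules\<close>

text \<open>An index outside \<open>I\<close> gives the zero family, so membership in the free
  module holds for every index. \<open>projective_lift\<close> relies on this when it chooses a
  preimage for each element of the index type.\<close>

definition unit_vec :: "('a, 'r) ring_scheme \<Rightarrow> 'i set \<Rightarrow> 'i \<Rightarrow> 'i \<Rightarrow> 'a" where
  "unit_vec R I i = (\<lambda>j\<in>I. if j = i then \<one>\<^bsub>R\<^esub> else \<zero>\<^bsub>R\<^esub>)"

lemma unit_vec_carrier:
  assumes "cring R"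
  shows "unit_vec R I i \<in> carrier (free_module R I)"
proof -
  interpret R: cring R by fact
  have "finite {j \<in> I. unit_vec R I i j \<noteq> \<zero>\<^bsub>R\<^esub>}"
    by (rule finite_subset[of _ "{i}"]) (auto simp: unit_vec_def)
  then show ?thesis
    by (intro free_module_carrierI) (auto simp: unit_vec_def)
qed

lemma free_module_upd_zero_hom:
  assumes "cring R" "j \<in> I"
  shows "(\<lambda>f. f(j := \<zero>\<^bsub>R\<^esub>)) \<in> mod_hom R (free_module R I) (free_module R I)"
proof -
  interpret R: cring R by fact
  note D = free_module_carrierD[where R = R and I = I]
  show ?thesis
  proof (rule mod_homI)
    fix f assume f: "f \<in> carrier (free_module R I)"
    show "f(j := \<zero>\<^bsub>R\<^esub>) \<in> carrier (free_module R I)"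
    proof (rule free_module_carrierI)
      show "finite {i \<in> I. (f(j := \<zero>\<^bsub>R\<^esub>)) i \<noteq> \<zero>\<^bsub>R\<^esub>}"
        by (rule finite_subset[OF _ D(3)[OF f]]) auto
    qed (use D(1,2)[OF f] assms(2) in \<open>auto simp: extensional_def\<close>)
  qed (use assms(2) in \<open>auto simp: free_module_simps fun_eq_iff\<close>)
qed

lemma free_module_split:
  assumes "cring R" "j \<in> I" "f \<in> carrier (free_module R I)"
  shows "f = f(j := \<zero>\<^bsub>R\<^esub>) \<oplus>\<^bsub>free_module R I\<^esub> f j \<odot>\<^bsub>free_module R I\<^esub> unit_vec R I j"
proof -
  interpret R: cring R by fact
  note D = free_module_carrierD[OF assms(3)]
  show ?thesis
    using D(1,2) assms(2)
    by (auto simp: free_module_simps fun_eq_iff unit_vec_def extensional_def restrict_def)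
qed

lemma free_module_generated:
  assumes "cring R" "submodule H R (free_module R I)" "\<And>i. i \<in> I \<Longrightarrow> unit_vec R I i \<in> H"
  shows "H = carrier (free_module R I)"
proof
  interpret R: cring R by fact
  interpret F: module R "free_module R I" by (rule free_module_module) fact
  note H = F.submoduleE[OF assms(2)]
  show "H \<subseteq> carrier (free_module R I)" by fact
  \<comment> \<open>The induction runs over a finite set containing the support rather than over the
    support itself, so a coordinate that is already zero may be cleared as well.\<close>
  have "f \<in> H" if "finite A" "f \<in> carrier (free_module R I)" "{i \<in> I. f i \<noteq> \<zero>\<^bsub>R\<^esub>} \<subseteq> A" for f A
    using that
  proof (induction A arbitrary: f rule: finite_induct)
    case empty
    have "f = \<zero>\<^bsub>free_module R I\<^esub>"
      using empty free_module_carrierD(1)[OF empty(1)]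
      by (auto simp: free_module_simps fun_eq_iff extensional_def restrict_def)
    then show ?case using submodule_zero_mem[OF assms(2)] by simp
  next
    case (insert j A)
    show ?case
    proof (cases "j \<in> I")
      case True
      have "f(j := \<zero>\<^bsub>R\<^esub>) \<in> H"
        using insert by (intro insert.IH mod_homD(1)[OF free_module_upd_zero_hom[OF assms(1) True]]) auto
      moreover have "f j \<odot>\<^bsub>free_module R I\<^esub> unit_vec R I j \<in> H"
        using insert assms(3) True free_module_carrierD(2)[OF insert.prems(1)] by (intro H(4)) auto
      ultimately show ?thesis
        by (subst free_module_split[OF assms(1) True insert.prems(1)]) (rule H(5))
    qed (use insert in auto)
  qed
  then show "carrier (free_module R I) \<subseteq> H" using free_module_carrierD(3) by blast
qed

text \<open>The kernel of the difference of \<open>f\<close> and \<open>g\<close> is a submodule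
  that contains the unit vectors.\<close>

lemma mod_hom_free_module_eqI:
  assumes "cring R" "module R M" "f \<in> mod_hom R (free_module R I) M" "g \<in> mod_hom R (free_module R I) M"
    and "\<And>i. i \<in> I \<Longrightarrow> f (unit_vec R I i) = g (unit_vec R I i)"
    and "x \<in> carrier (free_module R I)"
  shows "f x = g x"
proof -
  let ?F = "free_module R I" and ?h = "\<lambda>x. f x \<ominus>\<^bsub>M\<^esub> g x"
  note F = free_module_module[OF assms(1), of I]
  note fg = mod_homD(1)[OF assms(3)] mod_homD(1)[OF assms(4)]
  have "a_kernel ?F M ?h = carrier ?F"
    by (intro free_module_generated mod_hom_kernel_submodule mod_hom_subtract F assms(1-4))
      (auto simp: a_kernel_def' module_diff_eq_zero_iff[OF assms(2)] assms(5) fg unit_vec_carrier[OF assms(1)])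
  then show ?thesis
    using assms(6) module_diff_eq_zero_iff[OF assms(2) fg] by (auto simp: a_kernel_def')
qed

section \<open>Linear combinations and lifting from projective modules\<close>

text \<open>The sum runs over the support because \<open>finsum\<close> over an infinite index set
  is a mere default value.\<close>

definition lincomb ::
    "('a, 'r) ring_scheme \<Rightarrow> ('a, 'b, 'm) module_scheme \<Rightarrow> ('i \<Rightarrow> 'b) \<Rightarrow> 'i set \<Rightarrow> ('i \<Rightarrow> 'a) \<Rightarrow> 'b" where
  "lincomb R M y I f = finsum M (\<lambda>i. f i \<odot>\<^bsub>M\<^esub> y i) {i \<in> I. f i \<noteq> \<zero>\<^bsub>R\<^esub>}"

text \<open>Supports change under addition and scaling. Linearity is therefore proved by comparing
  sums over a common larger finite set.\<close>

lemma lincomb_eq_finsum: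
  assumes "module R M" "y \<in> I \<rightarrow> carrier M" "f \<in> carrier (free_module R I)"
    and "finite A" "A \<subseteq> I" "{i \<in> I. f i \<noteq> \<zero>\<^bsub>R\<^esub>} \<subseteq> A"
  shows "lincomb R M y I f = finsum M (\<lambda>i. f i \<odot>\<^bsub>M\<^esub> y i) A"
proof -
  interpret M: module R M by fact
  show ?thesis unfolding lincomb_def
    using assms(4-) free_module_carrierD(2)[OF assms(3)] funcset_mem[OF assms(2)]
    by (intro M.M.add.finprod_mono_neutral_cong_left) auto
qed

lemma lincomb_hom:
  assumes "module R M" "y \<in> I \<rightarrow> carrier M"
  shows "lincomb R M y I \<in> mod_hom R (free_module R I) M"
proof -
  interpret M: module R M by fact
  interpret F: module R "free_module R I" by (rule free_module_module[OF M.R.is_cring])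
  note D = free_module_carrierD[where R = R and I = I]
  note y = funcset_mem[OF assms(2)]
  show ?thesis
  proof (rule mod_homI)
    fix f assume f: "f \<in> carrier (free_module R I)"
    show "lincomb R M y I f \<in> carrier M"
      unfolding lincomb_def using D(2)[OF f] y by (intro M.M.finsum_closed) auto
    fix a assume a: "a \<in> carrier R"
    let ?A = "{i \<in> I. f i \<noteq> \<zero>\<^bsub>R\<^esub>}"
    have "lincomb R M y I (a \<odot>\<^bsub>free_module R I\<^esub> f)
        = finsum M (\<lambda>i. (a \<odot>\<^bsub>free_module R I\<^esub> f) i \<odot>\<^bsub>M\<^esub> y i) ?A"
      using a D(3)[OF f]
      by (intro lincomb_eq_finsum assms F.smult_closed f) (auto simp: free_module_simps)
    also have "\<dots> = finsum M (\<lambda>i. a \<odot>\<^bsub>M\<^esub> (f i \<odot>\<^bsub>M\<^esub> y i)) ?A"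
      using a D(2)[OF f] y
      by (intro M.M.finsum_cong') (auto simp: free_module_simps M.smult_assoc1)
    also have "\<dots> = a \<odot>\<^bsub>M\<^esub> lincomb R M y I f"
      unfolding lincomb_def using a D(2,3)[OF f] y
      by (intro M.finsum_smult_ldistr[symmetric]) auto
    finally show "lincomb R M y I (a \<odot>\<^bsub>free_module R I\<^esub> f) = a \<odot>\<^bsub>M\<^esub> lincomb R M y I f" .
  next
    fix f g assume f: "f \<in> carrier (free_module R I)" and g: "g \<in> carrier (free_module R I)"
    let ?A = "{i \<in> I. f i \<noteq> \<zero>\<^bsub>R\<^esub>} \<union> {i \<in> I. g i \<noteq> \<zero>\<^bsub>R\<^esub>}"
    have A: "finite ?A" "?A \<subseteq> I" using D(3)[OF f] D(3)[OF g] by auto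
    have "lincomb R M y I (f \<oplus>\<^bsub>free_module R I\<^esub> g)
        = finsum M (\<lambda>i. (f \<oplus>\<^bsub>free_module R I\<^esub> g) i \<odot>\<^bsub>M\<^esub> y i) ?A"
      using A by (intro lincomb_eq_finsum assms F.M.add.m_closed f g) (auto simp: free_module_simps)
    also have "\<dots> = finsum M (\<lambda>i. f i \<odot>\<^bsub>M\<^esub> y i \<oplus>\<^bsub>M\<^esub> g i \<odot>\<^bsub>M\<^esub> y i) ?A"
      using D(2)[OF f] D(2)[OF g] y
      by (intro M.M.finsum_cong') (auto simp: free_module_simps M.smult_l_distr)
    also have "\<dots> = finsum M (\<lambda>i. f i \<odot>\<^bsub>M\<^esub> y i) ?A \<oplus>\<^bsub>M\<^esub> finsum M (\<lambda>i. g i \<odot>\<^bsub>M\<^esub> y i) ?A"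
      using D(2)[OF f] D(2)[OF g] y by (intro M.M.finsum_addf) auto
    also have "finsum M (\<lambda>i. f i \<odot>\<^bsub>M\<^esub> y i) ?A = lincomb R M y I f"
      using f A by (intro lincomb_eq_finsum[symmetric] assms) auto
    also have "finsum M (\<lambda>i. g i \<odot>\<^bsub>M\<^esub> y i) ?A = lincomb R M y I g"
      using g A by (intro lincomb_eq_finsum[symmetric] assms) auto
    finally show "lincomb R M y I (f \<oplus>\<^bsub>free_module R I\<^esub> g) = lincomb R M y I f \<oplus>\<^bsub>M\<^esub> lincomb R M y I g" .
  qed
qed

lemma lincomb_unit_vec:
  assumes "module R M" "y \<in> I \<rightarrow> carrier M" "i \<in> I"
  shows "lincomb R M y I (unit_vec R I i) = y i"
proof -
  interpret M: module R M by fact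
  have "lincomb R M y I (unit_vec R I i) = finsum M (\<lambda>j. unit_vec R I i j \<odot>\<^bsub>M\<^esub> y j) {i}"
    using assms by (intro lincomb_eq_finsum unit_vec_carrier M.R.is_cring) (auto simp: unit_vec_def)
  also have "\<dots> = y i" using assms(3) funcset_mem[OF assms(2)]
    by (subst M.M.finsum_insert) (auto simp: unit_vec_def)
  finally show ?thesis .
qed

text \<open>The lift is defined by preimages of the values on unit vectors of a free module that has
  \<open>P\<close> as a summand. Comparing images, instead of asking \<open>g\<close> to be
  surjective, allows a map into a kernel to be lifted along the differential whose image is that
  kernel; this is how \<open>\<alpha>1\<close> arises.\<close>

lemma projective_lift:
  assumes "projective R P" "module R F" "module R M"
    and "g \<in> mod_hom R F M" "f \<in> mod_hom R P M" "f ` carrier P \<subseteq> g ` carrier F"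
  obtains h where "h \<in> mod_hom R P F" "\<And>x. x \<in> carrier P \<Longrightarrow> g (h x) = f x"
proof -
  interpret F: module R F by fact
  obtain I :: "'c set" and u v where uv: "u \<in> mod_hom R P (free_module R I)"
    "v \<in> mod_hom R (free_module R I) P" "\<And>x. x \<in> carrier P \<Longrightarrow> v (u x) = x"
    using assms(1) unfolding projective_def by blast
  have "\<exists>y\<in>carrier F. g y = f (v (unit_vec R I i))" for i
  proof -
    have "f (v (unit_vec R I i)) \<in> g ` carrier F"
      using assms(6) mod_homD(1)[OF uv(2) unit_vec_carrier[OF F.R.is_cring]] by blast
    then show ?thesis by auto
  qed
  then obtain y where y: "\<And>i. y i \<in> carrier F" "\<And>i. g (y i) = f (v (unit_vec R I i))" by metis
  have yI: "y \<in> I \<rightarrow> carrier F" using y(1) by auto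
  have eq: "g (lincomb R F y I x) = f (v x)" if "x \<in> carrier (free_module R I)" for x
    by (rule mod_hom_free_module_eqI[OF F.R.is_cring assms(3)
          mod_hom_comp[OF lincomb_hom[OF assms(2) yI] assms(4)] mod_hom_comp[OF uv(2) assms(5)] _ that])
      (simp add: lincomb_unit_vec[OF assms(2) yI] y)
  show thesis
    by (rule that[of "\<lambda>x. lincomb R F y I (u x)"])
      (auto intro!: mod_hom_comp[OF uv(1) lincomb_hom[OF assms(2) yI]] simp: eq mod_homD(1)[OF uv(1)] uv(3))
qed

section \<open>The regular module, coordinates and ideals\<close>

lemma regular_module_module:
  assumes "cring R"
  shows "module R (regular_module R)"
proof -
  interpret R: cring R by fact
  show ?thesis
  proof (rule moduleI)
    show "abelian_group (regular_module R)"
      by (rule abelian_groupI)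
        (auto simp: regular_module_def R.a_ac intro: R.add.l_inv_ex)
  qed (auto simp: regular_module_def R.l_distr R.r_distr R.m_assoc assms)
qed

lemma regular_module_simps [simp]:
  "carrier (regular_module R) = carrier R" "\<zero>\<^bsub>regular_module R\<^esub> = \<zero>\<^bsub>R\<^esub>"
  "add (regular_module R) = add R" "smult (regular_module R) = mult R"
  by (simp_all add: regular_module_def)

lemma regular_module_a_inv [simp]: "\<ominus>\<^bsub>regular_module R\<^esub> y = \<ominus>\<^bsub>R\<^esub> y"
  by (simp add: a_inv_def m_inv_def regular_module_def)

lemma regular_module_a_minus [simp]: "x \<ominus>\<^bsub>regular_module R\<^esub> y = x \<ominus>\<^bsub>R\<^esub> y"
  by (simp add: a_minus_def)

lemma free_module_component_hom:
  assumes "i \<in> I"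
  shows "(\<lambda>f. f i) \<in> mod_hom R (free_module R I) (regular_module R)"
  using assms by (intro mod_homI) (auto simp: free_module_simps dest: free_module_carrierD(2))

lemma free_module_a_minus:
  assumes "cring R" "f \<in> carrier (free_module R I)" "g \<in> carrier (free_module R I)" "i \<in> I"
  shows "(f \<ominus>\<^bsub>free_module R I\<^esub> g) i = f i \<ominus>\<^bsub>R\<^esub> g i"
  using mod_hom_diff[OF free_module_module regular_module_module free_module_component_hom] assms
  by fastforce

text \<open>The Noetherian hypothesis speaks of ideals; this makes it applicable to the coordinate
  images of submodules of R^n.\<close>

lemma regular_submodule_ideal:
  assumes "cring R" "submodule H R (regular_module R)"
  shows "ideal H R"
proof -
  interpret R: cring R by fact
  interpret M: module R "regular_module R" by (rule regular_module_module) fact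
  note H = M.submoduleE[OF assms(2)]
  show ?thesis
  proof (rule idealI)
    show "subgroup H (add_monoid R)"
      by (rule R.add.subgroupI) (use H in \<open>auto simp flip: a_inv_def\<close>)
    show "x \<otimes>\<^bsub>R\<^esub> a \<in> H" if "a \<in> H" "x \<in> carrier R" for a x using H(4)[OF that(2,1)] by simp
    then show "a \<otimes>\<^bsub>R\<^esub> x \<in> H" if "a \<in> H" "x \<in> carrier R" for a x
      using H(1) that by (subst R.m_comm) auto
  qed (rule R.ring_axioms)
qed

section \<open>Submodules of finite free modules over a Noetherian ring\<close>

lemma submodule_Int:
  assumes "module R M" "submodule H R M" "submodule K R M"
  shows "submodule (H \<inter> K) R M"
proof -
  interpret M: module R M by fact
  note H = M.submoduleE[OF assms(2)] and K = M.submoduleE[OF assms(3)]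
  show ?thesis
    by (rule M.submoduleI) (use H K submodule_zero_mem[OF assms(2)] submodule_zero_mem[OF assms(3)] in auto)
qed

lemma submodule_of_submodule:
  assumes "module R M" "submodule H R M" "submodule K R (M\<lparr>carrier := H\<rparr>)"
  shows "submodule K R M"
proof -
  interpret M: module R M by fact
  have "(\<lambda>x. x) \<in> mod_hom R (M\<lparr>carrier := H\<rparr>) M"
    using M.submoduleE(1)[OF assms(2)] by (auto simp: mod_hom_def)
  from mod_hom_image_submodule[OF submodule_module[OF assms(1,2)] assms(1) this assms(3)]
  show ?thesis by simp
qed

text \<open>Induction peels off the last coordinate: its values on \<open>H\<close> form a finitely
  generated ideal, and the elements of \<open>H\<close> on which it vanishes fall under the
  induction hypothesis. The bound \<open>m\<close> on the nonzero coordinates moves while the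
  ambient R^n stays fixed, so no smaller free module has to be embedded.\<close>

lemma noetherian_submodule_finite_basis:
  fixes R :: "('a, 'r) ring_scheme" and n :: nat
  assumes "noetherian_ring R" "cring R" "m \<le> n" "submodule H R (free_module R {..<n})"
    and "\<And>x i. x \<in> H \<Longrightarrow> m \<le> i \<Longrightarrow> i < n \<Longrightarrow> x i = \<zero>\<^bsub>R\<^esub>"
  shows "\<exists>A. finite A \<and> A \<subseteq> H \<and> (\<forall>K. submodule K R (free_module R {..<n}) \<and> A \<subseteq> K \<longrightarrow> H \<subseteq> K)"
  using assms(3-)
proof (induction m arbitrary: H)
  case 0
  interpret R: cring R by fact
  interpret F: module R "free_module R {..<n}" by (rule free_module_module) fact
  have "H \<subseteq> {\<zero>\<^bsub>free_module R {..<n}\<^esub>}"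
  proof
    fix x assume x: "x \<in> H"
    with F.submoduleE(1)[OF 0(2)] have "x \<in> extensional {..<n}" by (auto dest: free_module_carrierD)
    then show "x \<in> {\<zero>\<^bsub>free_module R {..<n}\<^esub>}" using 0(3)[OF x]
      by (auto simp: free_module_simps fun_eq_iff extensional_def restrict_def)
  qed
  then show ?case using submodule_zero_mem by (intro exI[of _ "{}"]) blast
next
  case (Suc m)
  interpret R: noetherian_ring R by fact
  interpret R: cring R by fact
  let ?F = "free_module R {..<n}" and ?\<pi> = "\<lambda>x. x m"
  have F: "module R ?F" by (rule free_module_module) fact
  interpret F: module R ?F by fact
  have \<pi>: "?\<pi> \<in> mod_hom R ?F (regular_module R)"
    by (rule free_module_component_hom) (use Suc.prems in auto)
  note reg = regular_module_module[OF assms(2)]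
  have id: "ideal (?\<pi> ` K) R" if "submodule K R ?F" for K
    by (rule regular_submodule_ideal[OF assms(2) mod_hom_image_submodule[OF F reg \<pi> that]])
  note H = F.submoduleE[OF Suc.prems(2)]
  obtain B where B: "B \<subseteq> carrier R" "finite B" "?\<pi> ` H = Idl\<^bsub>R\<^esub> B"
    using R.finetely_gen[OF id[OF Suc.prems(2)]] by blast
  have "B \<subseteq> ?\<pi> ` H" using R.genideal_self[OF B(1)] B(3) by simp
  then obtain C where C: "finite C" "C \<subseteq> H" "B = ?\<pi> ` C"
    using finite_subset_image[OF B(2)] by metis
  let ?H0 = "H \<inter> a_kernel ?F (regular_module R) ?\<pi>"
  have H0: "submodule ?H0 R ?F"
    by (intro submodule_Int mod_hom_kernel_submodule F reg \<pi> Suc.prems)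
  have "\<exists>A. finite A \<and> A \<subseteq> ?H0 \<and> (\<forall>K. submodule K R ?F \<and> A \<subseteq> K \<longrightarrow> ?H0 \<subseteq> K)"
  proof (rule Suc.IH[OF _ H0])
    fix x i assume "x \<in> ?H0" "m \<le> i" "i < n"
    then show "x i = \<zero>\<^bsub>R\<^esub>" using Suc.prems(3)[of x i] by (cases "i = m") (auto simp: a_kernel_def')
  qed (use Suc.prems in auto)
  then obtain A where A: "finite A" "A \<subseteq> ?H0"
    and A_min: "\<forall>K. submodule K R ?F \<and> A \<subseteq> K \<longrightarrow> ?H0 \<subseteq> K" by (elim exE conjE)
  have "H \<subseteq> K" if K: "submodule K R ?F" "A \<union> C \<subseteq> K" for K
  proof
    fix x assume x: "x \<in> H"
    \<comment> \<open>The right side is an ideal that contains the generators \<open>B\<close>.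
      Hence some \<open>y\<close> in \<open>K\<close> has the same coordinate \<open>m\<close> as
      \<open>x\<close>; taking \<open>y\<close> in \<open>H\<close> as well keeps the difference
      inside \<open>H\<close>, where the induction hypothesis covers it.\<close>
    have "?\<pi> ` H \<subseteq> ?\<pi> ` (K \<inter> H)"
      unfolding B(3) using K C
      by (intro R.genideal_minimal id submodule_Int F Suc.prems(2)) auto
    then have "x m \<in> ?\<pi> ` (K \<inter> H)" using x by blast
    then obtain y where y: "y \<in> K" "y \<in> H" "x m = y m" by auto
    have xF: "x \<in> carrier ?F" and yF: "y \<in> carrier ?F" using x y H(1) by auto
    have "x \<ominus>\<^bsub>?F\<^esub> y \<in> H" unfolding a_minus_def using x y H by auto
    moreover have "?\<pi> (x \<ominus>\<^bsub>?F\<^esub> y) = \<zero>\<^bsub>R\<^esub>"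
      using Suc.prems(1) free_module_carrierD(2)[OF yF, of m] y(3)
      by (subst free_module_a_minus[OF assms(2) xF yF]) (auto simp: a_minus_def R.r_neg)
    ultimately have "x \<ominus>\<^bsub>?F\<^esub> y \<in> K"
      using A_min[rule_format, of K] K xF yF H(1) by (auto simp: a_kernel_def')
    then have "(x \<ominus>\<^bsub>?F\<^esub> y) \<oplus>\<^bsub>?F\<^esub> y \<in> K" using y F.submoduleE(5)[OF K(1)] by blast
    moreover have "(x \<ominus>\<^bsub>?F\<^esub> y) \<oplus>\<^bsub>?F\<^esub> y = x"
      using xF yF by (simp add: a_minus_def F.M.a_assoc F.M.l_neg)
    ultimately show "x \<in> K" by simp
  qed
  then show ?case using A C by (intro exI[of _ "A \<union> C"]) simp
qed

lemma noetherian_submodule_finitely_generated: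
  fixes R :: "('a, 'r) ring_scheme" and n :: nat
  assumes "noetherian_ring R" "cring R" "submodule H R (free_module R {..<n})"
  shows "finitely_generated R ((free_module R {..<n})\<lparr>carrier := H\<rparr>)"
proof -
  let ?F = "free_module R {..<n}"
  have F: "module R ?F" by (rule free_module_module) fact
  obtain A where A: "finite A" "A \<subseteq> H" "\<And>K. submodule K R ?F \<Longrightarrow> A \<subseteq> K \<Longrightarrow> H \<subseteq> K"
    using noetherian_submodule_finite_basis[OF assms(1,2) order_refl assms(3)] by force
  have "K = H" if K: "submodule K R (?F\<lparr>carrier := H\<rparr>)" "A \<subseteq> K" for K
    using A(3)[OF submodule_of_submodule[OF F assms(3) K(1)] K(2)]
      module.submoduleE(1)[OF submodule_module[OF F assms(3)] K(1)] by simp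
  then show ?thesis using A unfolding finitely_generated_def by (intro exI[of _ A]) auto
qed

lemma free_module_finitely_generated:
  fixes n :: nat
  assumes "cring R"
  shows "finitely_generated R (free_module R {..<n})"
  unfolding finitely_generated_def
proof (intro exI conjI allI impI)
  show "unit_vec R {..<n} ` {..<n} \<subseteq> carrier (free_module R {..<n})"
    using unit_vec_carrier[OF assms] by auto
  show "H = carrier (free_module R {..<n})"
    if "submodule H R (free_module R {..<n}) \<and> unit_vec R {..<n} ` {..<n} \<subseteq> H" for H
    using that by (intro free_module_generated[OF assms]) auto
qed simp


section \<open>Minimal free resolutions over a Noetherian local ring\<close>

lemma local_ring_max_ideal:
  assumes "local_ring R"
  shows "maximalideal (max_ideal R) R"
  using assms unfolding local_ring_def max_ideal_def by (metis (no_types) theI')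

lemma local_ring_one_not_zero:
  assumes "local_ring R"
  shows "\<one>\<^bsub>R\<^esub> \<noteq> \<zero>\<^bsub>R\<^esub>"
proof
  interpret R: cring R using assms by (simp add: local_ring_def)
  interpret I: maximalideal "max_ideal R" R using assms by (rule local_ring_max_ideal)
  assume "\<one>\<^bsub>R\<^esub> = \<zero>\<^bsub>R\<^esub>"
  then have "\<one>\<^bsub>R\<^esub> \<in> max_ideal R" by simp
  then show False using I.one_imp_carrier I.I_notcarr by simp
qed

text \<open>In a Noetherian ring a nonempty chain of ideals contains its union, so the upper bound
  required by Zorn's lemma is a member of the chain.\<close>

lemma noetherian_proper_ideal_le_maximal:
  assumes "noetherian_ring R" "ideal I R" "\<one>\<^bsub>R\<^esub> \<notin> I"
  obtains J where "maximalideal J R" "I \<subseteq> J"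
proof -
  interpret R: noetherian_ring R by fact
  let ?S = "{J. ideal J R \<and> I \<subseteq> J \<and> \<one>\<^bsub>R\<^esub> \<notin> J}"
  have "\<exists>J\<in>?S. \<forall>X\<in>?S. J \<subseteq> X \<longrightarrow> X = J"
  proof (rule subset_Zorn_nonempty)
    show "?S \<noteq> {}" using assms(2,3) by blast
    fix C assume C: "C \<noteq> {}" "subset.chain ?S C"
    then have "subset.chain {J. ideal J R} C" by (auto simp: subset_chain_def)
    then have "\<Union>C \<in> C" using R.ideal_chain_is_trivial C(1) by blast
    then show "\<Union>C \<in> ?S" using C(2) unfolding subset_chain_def by blast
  qed
  then obtain J where J: "ideal J R" "I \<subseteq> J" "\<one>\<^bsub>R\<^esub> \<notin> J"
    and max: "\<forall>X\<in>?S. J \<subseteq> X \<longrightarrow> X = J" by (elim bexE) auto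
  have "maximalideal J R"
  proof (rule maximalidealI)
    show "carrier R \<noteq> J" using J(3) R.one_closed by blast
    fix X assume X: "ideal X R" "J \<subseteq> X" "X \<subseteq> carrier R"
    show "X = J \<or> X = carrier R"
    proof (cases "\<one>\<^bsub>R\<^esub> \<in> X")
      case True
      then show ?thesis using ideal.one_imp_carrier[OF X(1)] by simp
    next
      case False
      then have "X \<in> ?S" using X J by auto
      then show ?thesis using max X(2) by (metis (lifting))
    qed
  qed (rule J)
  then show thesis using J(2) that by (metis (lifting))
qed

text \<open>The principal ideal of a nonunit is proper, so it lies in a maximal ideal, and there is
  only one.\<close>

lemma noetherian_local_ring_unit:
  assumes "noetherian_ring R" "local_ring R" "a \<in> carrier R" "a \<notin> max_ideal R"
  shows "a \<in> Units R"
proof (rule ccontr)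
  interpret R: cring R using assms(2) by (simp add: local_ring_def)
  assume a: "a \<notin> Units R"
  have id: "ideal (PIdl\<^bsub>R\<^esub> a) R" by (rule R.cgenideal_ideal) fact
  have "\<one>\<^bsub>R\<^esub> \<notin> PIdl\<^bsub>R\<^esub> a"
  proof
    assume "\<one>\<^bsub>R\<^esub> \<in> PIdl\<^bsub>R\<^esub> a"
    then obtain b where b: "b \<in> carrier R" "\<one>\<^bsub>R\<^esub> = b \<otimes>\<^bsub>R\<^esub> a" unfolding cgenideal_def by blast
    then have "a \<in> Units R" unfolding Units_def using assms(3) R.m_comm[of a b] by auto
    with a show False by simp
  qed
  then obtain J where J: "maximalideal J R" "PIdl\<^bsub>R\<^esub> a \<subseteq> J"
    using noetherian_proper_ideal_le_maximal[OF assms(1) id] by (metis (lifting))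
  have "J = max_ideal R"
    using assms(2) J(1) local_ring_max_ideal[OF assms(2)] unfolding local_ring_def by (elim conjE ex1E) metis
  then show False using R.cgenideal_self[OF assms(3)] J(2) assms(4) by blast
qed

text \<open>A generating set of least cardinality has no relation with a unit among its coefficients.\<close>

lemma minimal_free_cover:
  fixes M :: "('a, 'b, 'm) module_scheme"
  assumes "noetherian_ring R" "local_ring R" "module R M" "finitely_generated R M"
  obtains n :: nat and e where "e \<in> mod_hom R (free_module R {..<n}) M"
    "e ` carrier (free_module R {..<n}) = carrier M"
    "\<And>x j. x \<in> carrier (free_module R {..<n}) \<Longrightarrow> e x = \<zero>\<^bsub>M\<^esub> \<Longrightarrow> j < n \<Longrightarrow> x j \<in> max_ideal R"
proof -
  interpret M: module R M by fact
  have R: "cring R" by (rule M.R.is_cring)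
  define gen where "gen A \<longleftrightarrow> finite A \<and> A \<subseteq> carrier M \<and>
    (\<forall>H. submodule H R M \<and> A \<subseteq> H \<longrightarrow> H = carrier M)" for A
  obtain A0 where "gen A0" using assms(4) by (auto simp: finitely_generated_def gen_def)
  then obtain A where "gen A" and min: "\<And>B. gen B \<Longrightarrow> card A \<le> card B"
    using ex_has_least_nat[of gen A0 card] by blast
  then have A: "finite A" "A \<subseteq> carrier M" "\<And>H. submodule H R M \<Longrightarrow> A \<subseteq> H \<Longrightarrow> H = carrier M"
    by (auto simp: gen_def)
  define n where "n = card A"
  let ?F = "free_module R {..<n}"
  obtain y where y: "bij_betw y {..<n} A"
    using ex_bij_betw_nat_finite[of A] A(1) by (auto simp: n_def atLeast0LessThan)
  have yM: "y \<in> {..<n} \<rightarrow> carrier M" using bij_betwE[OF y] A(2) by auto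
  define e where "e = lincomb R M y {..<n}"
  have F: "module R ?F" by (rule free_module_module[OF R])
  have e: "e \<in> mod_hom R ?F M" unfolding e_def by (rule lincomb_hom[OF assms(3) yM])
  have e_unit: "e (unit_vec R {..<n} i) = y i" if "i < n" for i
    unfolding e_def using that by (intro lincomb_unit_vec[OF assms(3) yM]) auto
  have "submodule (e ` carrier ?F) R M"
    by (intro mod_hom_image_submodule[OF F assms(3) e] module.carrier_is_submodule F)
  moreover have "A \<subseteq> e ` carrier ?F"
  proof
    fix a assume "a \<in> A"
    then obtain i where "i < n" "a = y i" using y unfolding bij_betw_def by blast
    then show "a \<in> e ` carrier ?F"
      by (intro image_eqI[of _ _ "unit_vec R {..<n} i"] unit_vec_carrier[OF R]) (simp add: e_unit)
  qed
  ultimately have surj: "e ` carrier ?F = carrier M" by (rule A(3))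
  have "x j \<in> max_ideal R" if x: "x \<in> carrier ?F" "e x = \<zero>\<^bsub>M\<^esub>" "j < n" for x j
  proof (rule ccontr)
    assume nj: "x j \<notin> max_ideal R"
    have xj: "x j \<in> carrier R" using free_module_carrierD(2)[OF x(1)] x(3) by simp
    have unit: "x j \<in> Units R" by (rule noetherian_local_ring_unit[OF assms(1,2) xj nj])
    have yA: "y i \<in> A" if "i < n" for i using bij_betwE[OF y] that by auto
    note yj = yA[OF x(3)]
    \<comment> \<open>A unit coefficient allows the relation \<open>x\<close> to be solved for
      \<open>y j\<close>. The other elements of \<open>A\<close> then generate \<open>M\<close>,
      against the choice of \<open>A\<close>.\<close>
    have "H = carrier M" if H: "submodule H R M" "A - {y j} \<subseteq> H" for H
    proof -
      note HE = M.submoduleE[OF H(1)]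
      let ?u = "\<lambda>f. f(j := \<zero>\<^bsub>R\<^esub>)"
      have u: "?u \<in> mod_hom R ?F ?F" using x(3) by (intro free_module_upd_zero_hom[OF R]) auto
      have ue: "(\<lambda>f. e (?u f)) \<in> mod_hom R ?F M" by (rule mod_hom_comp[OF u e])
      \<comment> \<open>Clearing coordinate \<open>j\<close> before applying \<open>e\<close> kills
        the unit vector of \<open>j\<close> and sends every other one into \<open>H\<close>. Applied
        to \<open>x\<close>, this puts the relation without its \<open>j\<close>-th term into
        \<open>H\<close>.\<close>
      have *: "{f \<in> carrier ?F. e (?u f) \<in> H} = carrier ?F"
      proof (rule free_module_generated[OF R mod_hom_vimage_submodule[OF F assms(3) ue H(1)]])
        fix i assume i: "i \<in> {..<n}"
        show "unit_vec R {..<n} i \<in> {f \<in> carrier ?F. e (?u f) \<in> H}"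
        proof (cases "i = j")
          case True
          have "?u (unit_vec R {..<n} i) = \<zero>\<^bsub>?F\<^esub>"
            using True x(3) by (auto simp: unit_vec_def free_module_simps fun_eq_iff)
          then show ?thesis
            using mod_hom_zero[OF F assms(3) e] submodule_zero_mem[OF H(1)] unit_vec_carrier[OF R] by simp
        next
          case False
          have "?u (unit_vec R {..<n} i) = unit_vec R {..<n} i"
            using False x(3) by (auto simp: unit_vec_def fun_eq_iff)
          moreover have "y i \<in> A - {y j}"
            using False i x(3) inj_onD[OF bij_betw_imp_inj_on[OF y], of i j] yA by auto
          ultimately show ?thesis using H(2) e_unit i unit_vec_carrier[OF R] by auto
        qed
      qed
      then have inH: "e (?u x) \<in> H" using x(1) by blast
      have uxF: "?u x \<in> carrier ?F" by (rule mod_homD(1)[OF u x(1)])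
      interpret F: module R ?F by fact
      have "\<zero>\<^bsub>M\<^esub> = e (?u x \<oplus>\<^bsub>?F\<^esub> x j \<odot>\<^bsub>?F\<^esub> unit_vec R {..<n} j)"
        using free_module_split[OF R _ x(1), of j] x(2,3) by simp
      also have "\<dots> = e (?u x) \<oplus>\<^bsub>M\<^esub> x j \<odot>\<^bsub>M\<^esub> y j"
        using uxF unit_vec_carrier[OF R, of "{..<n}" j] xj
        by (simp add: mod_homD(2,3)[OF e] e_unit[OF x(3)])
      finally have "x j \<odot>\<^bsub>M\<^esub> y j = \<ominus>\<^bsub>M\<^esub> e (?u x)"
        using xj A(2) yj mod_homD(1)[OF e uxF]
        by (intro M.M.minus_equality[symmetric]) (auto simp: M.M.a_comm)
      then have "x j \<odot>\<^bsub>M\<^esub> y j \<in> H" using HE(3)[OF inH] by simp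
      then have "inv\<^bsub>R\<^esub> (x j) \<odot>\<^bsub>M\<^esub> (x j \<odot>\<^bsub>M\<^esub> y j) \<in> H"
        by (rule HE(4)[OF M.R.Units_inv_closed[OF unit]])
      moreover have "inv\<^bsub>R\<^esub> (x j) \<odot>\<^bsub>M\<^esub> (x j \<odot>\<^bsub>M\<^esub> y j) = y j"
        using A(2) yj unit xj by (auto simp flip: M.smult_assoc1)
      ultimately have "A \<subseteq> H" using H(2) by auto
      then show "H = carrier M" by (rule A(3)[OF H(1)])
    qed
    then have "card A \<le> card (A - {y j})" using A(1,2) by (intro min) (auto simp: gen_def \<open>\<And>H. submodule H R M \<Longrightarrow> A - {y j} \<subseteq> H \<Longrightarrow> H = carrier M\<close>)
    then show False using yj A(1) card_Diff1_less[of A "y j"] by simp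
  qed
  then show thesis using that[OF e surj] by simp
qed

text \<open>The kernel of a cover by R^n is finitely generated over a Noetherian ring, so minimal
  covers can be iterated forever; the iteration is a dependent choice.\<close>

lemma minimal_free_resolution_exists:
  fixes M :: "('a, 'b, 'm) module_scheme"
  assumes "noetherian_ring R" "local_ring R" "module R M" "finitely_generated R M"
  shows "\<exists>b d e. minimal_free_resolution R b d e M"
proof -
  have R: "cring R" using assms(2) by (simp add: local_ring_def)
  let ?F = "\<lambda>n::nat. free_module R {..<n}"
  note F = free_module_module[OF R]
  obtain b0 e where e: "e \<in> mod_hom R (?F b0) M" "e ` carrier (?F b0) = carrier M"
    "\<And>x j. x \<in> carrier (?F b0) \<Longrightarrow> e x = \<zero>\<^bsub>M\<^esub> \<Longrightarrow> j < b0 \<Longrightarrow> x j \<in> max_ideal R"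
    using minimal_free_cover[OF assms] by (metis (lifting))
  \<comment> \<open>A state \<open>(n, K)\<close> holds the current rank and the kernel in R^n that
    the next cover has to hit. The entries of \<open>K\<close> lie in the maximal ideal, which
    becomes the minimality of the differential onto \<open>K\<close>. The index pins the initial
    state to the kernel of the augmentation.\<close>
  let ?P = "\<lambda>i s. (i = (0::nat) \<longrightarrow> s = (b0, a_kernel (?F b0) M e)) \<and>
    submodule (snd s) R (?F (fst s)) \<and> (\<forall>x\<in>snd s. \<forall>j<fst s. x j \<in> max_ideal R)"
  let ?Q = "\<lambda>(i::nat) s t. \<exists>g. g \<in> mod_hom R (?F (fst t)) (?F (fst s)) \<and>
    g ` carrier (?F (fst t)) = snd s \<and> a_kernel (?F (fst t)) (?F (fst s)) g = snd t"
  have "\<exists>f. \<forall>i. ?P i (f i) \<and> ?Q i (f i) (f (Suc i))"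
  proof (rule dependent_nat_choice)
    show "\<exists>s. ?P 0 s"
      using e mod_hom_kernel_submodule[OF F assms(3) e(1)]
      by (intro exI[of _ "(b0, a_kernel (?F b0) M e)"]) (auto simp: a_kernel_def')
  next
    fix s :: "nat \<times> (nat \<Rightarrow> 'a) set" and i
    assume P: "?P i s"
    obtain n K where s: "s = (n, K)" by fastforce
    from P have K: "submodule K R (?F n)" by (simp add: s)
    let ?K = "(?F n)\<lparr>carrier := K\<rparr>"
    obtain n' g where g: "g \<in> mod_hom R (?F n') ?K" "g ` carrier (?F n') = carrier ?K"
      "\<And>x j. x \<in> carrier (?F n') \<Longrightarrow> g x = \<zero>\<^bsub>?K\<^esub> \<Longrightarrow> j < n' \<Longrightarrow> x j \<in> max_ideal R"
      using minimal_free_cover[OF assms(1,2) submodule_module[OF F K]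
          noetherian_submodule_finitely_generated[OF assms(1) R K]] by (metis (lifting))
    have g': "g \<in> mod_hom R (?F n') (?F n)"
      by (rule mod_hom_extend_target[OF g(1) module.submoduleE(1)[OF F K]])
    let ?t = "(n', a_kernel (?F n') (?F n) g)"
    have "?P (Suc i) ?t"
      using mod_hom_kernel_submodule[OF F F g'] g(3) by (auto simp: a_kernel_def')
    moreover have "?Q i s ?t" using g' g(2) by (auto simp: s)
    ultimately show "\<exists>t. ?P (Suc i) t \<and> ?Q i s t" by blast
  qed
  then obtain f where f: "\<And>i. ?P i (f i)" "\<And>i. ?Q i (f i) (f (Suc i))" by (elim exE) metis
  define b where "b = fst \<circ> f"
  define K where "K = snd \<circ> f"
  have "\<exists>d. \<forall>i. d i \<in> mod_hom R (?F (b (Suc i))) (?F (b i)) \<and>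
      d i ` carrier (?F (b (Suc i))) = K i \<and> a_kernel (?F (b (Suc i))) (?F (b i)) (d i) = K (Suc i)"
    using f(2) by (intro choice) (simp add: b_def K_def)
  then obtain d where d: "\<And>i. d i \<in> mod_hom R (?F (b (Suc i))) (?F (b i))"
    "\<And>i. d i ` carrier (?F (b (Suc i))) = K i"
    "\<And>i. a_kernel (?F (b (Suc i))) (?F (b i)) (d i) = K (Suc i)" by (elim exE) metis
  have b0: "b 0 = b0" "K 0 = a_kernel (?F b0) M e" using f(1)[of 0] by (simp_all add: b_def K_def)
  have "\<forall>x\<in>carrier (?F (b (Suc i))). \<forall>j<b i. d i x j \<in> max_ideal R" for i
    using f(1)[of i] d(2)[of i] by (auto simp: b_def K_def)
  then have "minimal_free_resolution R b d e M"
    unfolding minimal_free_resolution_def resolution_def using d e b0 by (simp add: F)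
  then show ?thesis by blast
qed

section \<open>Projectivity of summands of finite free modules\<close>

text \<open>Reindexing is contravariant in \<open>\<rho>\<close>; a finite \<open>J\<close> keeps
  supports finite even when \<open>\<rho>\<close> is not injective.\<close>

lemma free_module_reindex_hom:
  assumes "cring R" "\<rho> \<in> J \<rightarrow> I" "finite J"
  shows "(\<lambda>f. \<lambda>j\<in>J. f (\<rho> j)) \<in> mod_hom R (free_module R I) (free_module R J)"
proof (rule mod_homI)
  fix f assume f: "f \<in> carrier (free_module R I)"
  then show "(\<lambda>j\<in>J. f (\<rho> j)) \<in> carrier (free_module R J)"
    using assms(2,3) by (intro free_module_carrierI) (auto dest: free_module_carrierD(2))
qed (use funcset_mem[OF assms(2)] in \<open>auto simp: free_module_simps fun_eq_iff\<close>)

text \<open>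
  \<^const>\<open>projective\<close> asks for a free module indexed by the type of module elements, so the finite
  index set has to be embedded into that type, along the standard unit vectors.
\<close>

lemma projective_summand:
  fixes X :: "('a, nat \<Rightarrow> 'a, 'm) module_scheme" and n :: nat
  assumes "module R X" "\<one>\<^bsub>R\<^esub> \<noteq> \<zero>\<^bsub>R\<^esub>"
    and "u \<in> mod_hom R X (free_module R {..<n})" "v \<in> mod_hom R (free_module R {..<n}) X"
    and "\<And>x. x \<in> carrier X \<Longrightarrow> v (u x) = x"
  shows "projective R X"
proof -
  interpret X: module R X by fact
  define \<iota> :: "nat \<Rightarrow> nat \<Rightarrow> 'a" where "\<iota> = unit_vec R UNIV"
  \<comment> \<open>Unit vectors of distinct indices are distinct precisely because
    \<open>\<one>\<close> and \<open>\<zero>\<close> differ.\<close>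
  have "inj \<iota>"
    by (rule injI) (use assms(2) in \<open>auto simp: \<iota>_def unit_vec_def fun_eq_iff split: if_splits\<close>)
  then have inv: "inv_into UNIV \<iota> (\<iota> i) = i" for i by simp
  let ?J = "\<iota> ` {..<n}"
  let ?u = "\<lambda>f. \<lambda>j\<in>?J. f (inv_into UNIV \<iota> j)" and ?v = "\<lambda>f. \<lambda>i\<in>{..<n}. f (\<iota> i)"
  have u: "?u \<in> mod_hom R (free_module R {..<n}) (free_module R ?J)"
    by (rule free_module_reindex_hom) (auto simp: inv X.R.is_cring)
  have v: "?v \<in> mod_hom R (free_module R ?J) (free_module R {..<n})"
    by (rule free_module_reindex_hom) (auto simp: X.R.is_cring)
  have "?v (?u f) = f" if "f \<in> carrier (free_module R {..<n})" for f
    using free_module_carrierD(1)[OF that] by (auto simp: fun_eq_iff inv extensional_def)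
  then have "v (?v (?u (u x))) = x" if "x \<in> carrier X" for x
    using mod_homD(1)[OF assms(3) that] assms(5)[OF that] by simp
  then show ?thesis unfolding projective_def
    using mod_hom_comp[OF assms(3) u] mod_hom_comp[OF v assms(4)] assms(1) by blast
qed

lemma projective_free_module:
  fixes n :: nat
  assumes "cring R" "\<one>\<^bsub>R\<^esub> \<noteq> \<zero>\<^bsub>R\<^esub>"
  shows "projective R (free_module R {..<n})"
  by (rule projective_summand[where u = "\<lambda>x. x" and v = "\<lambda>x. x" and n = n])
    (auto simp: mod_hom_def assms free_module_module)


section \<open>Vanishing of Ext and splitting\<close>

lemma direct_sum_simps [simp]:
  "carrier (direct_sum M N) = carrier M \<times> carrier N"
  "\<zero>\<^bsub>direct_sum M N\<^esub> = (\<zero>\<^bsub>M\<^esub>, \<zero>\<^bsub>N\<^esub>)"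
  "(x, y) \<oplus>\<^bsub>direct_sum M N\<^esub> (x', y') = (x \<oplus>\<^bsub>M\<^esub> x', y \<oplus>\<^bsub>N\<^esub> y')"
  "a \<odot>\<^bsub>direct_sum M N\<^esub> (x, y) = (a \<odot>\<^bsub>M\<^esub> x, a \<odot>\<^bsub>N\<^esub> y)"
  by (simp_all add: direct_sum_def)

lemma direct_sum_fst_hom: "fst \<in> mod_hom R (direct_sum M N) M"
  and direct_sum_snd_hom: "snd \<in> mod_hom R (direct_sum M N) N"
  by (auto simp: mod_hom_def)

lemma direct_sum_pair_hom:
  assumes "f \<in> mod_hom R X M" "g \<in> mod_hom R X N"
  shows "(\<lambda>x. (f x, g x)) \<in> mod_hom R X (direct_sum M N)"
  by (rule mod_homI) (auto simp: mod_homD[OF assms(1)] mod_homD[OF assms(2)])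

lemma zero_mod_hom:
  assumes "module R N"
  shows "(\<lambda>x. \<zero>\<^bsub>N\<^esub>) \<in> mod_hom R M N"
proof -
  interpret N: module R N by fact
  show ?thesis by (auto simp: mod_hom_def)
qed

lemma mod_hom_restrict:
  assumes "module R M" "f \<in> mod_hom R M N"
  shows "restrict f (carrier M) \<in> mod_hom R M N"
proof -
  interpret M: module R M by fact
  show ?thesis by (rule mod_homI) (auto simp: mod_homD[OF assms(2)])
qed

text \<open>This is the form in which vanishing of Ext is used: a cocycle is a coboundary. It is
  read off from cosets, since the only coset is the set of coboundaries itself. \<open>N\<close>
  enters through two weak facts about its zero, so a direct sum never has to be shown to be a
  module.\<close>

lemma hom_cohomology_zero_factor:
  assumes "zero_module (hom_cohomology R P d N (Suc i))"
    and "module R (P i)" "module R (P (Suc i))" "d i \<in> mod_hom R (P (Suc i)) (P i)"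
    and "d (Suc i) \<in> mod_hom R (P (Suc (Suc i))) (P (Suc i))"
    and "\<And>y. y \<in> carrier N \<Longrightarrow> \<zero>\<^bsub>N\<^esub> \<oplus>\<^bsub>N\<^esub> y = y" "(\<lambda>x. \<zero>\<^bsub>N\<^esub>) \<in> mod_hom R (P i) N"
    and "f \<in> mod_hom R (P (Suc i)) N"
    and "\<And>x. x \<in> carrier (P (Suc (Suc i))) \<Longrightarrow> f (d (Suc i) x) = \<zero>\<^bsub>N\<^esub>"
  obtains g where "g \<in> mod_hom R (P i) N" "\<And>x. x \<in> carrier (P (Suc i)) \<Longrightarrow> f x = g (d i x)"
proof -
  let ?X = "carrier (P (Suc i))"
  let ?H = "(hom_module R (P (Suc i)) N)\<lparr>carrier := hom_cocycles R P d N (Suc i)\<rparr>"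
  let ?B = "hom_coboundaries R P d N (Suc i)" and ?f = "restrict f ?X"
  have f: "?f \<in> hom_cocycles R P d N (Suc i)"
    using mod_hom_restrict[OF assms(3,8)] assms(9) mod_homD(1)[OF assms(5)]
    by (auto simp: hom_cocycles_def hom_module_def)
  \<comment> \<open>Zero is shown to be a coboundary in order to place \<open>?f\<close> in its own
    coset.\<close>
  have "(\<lambda>x\<in>carrier (P i). \<zero>\<^bsub>N\<^esub>) \<in> carrier (hom_module R (P i) N)"
    using mod_hom_restrict[OF assms(2,7)] by (simp add: hom_module_def)
  then have "compose ?X (\<lambda>x\<in>carrier (P i). \<zero>\<^bsub>N\<^esub>) (d i) \<in> ?B"
    by (auto simp: hom_coboundaries_def)
  moreover have "compose ?X (\<lambda>x\<in>carrier (P i). \<zero>\<^bsub>N\<^esub>) (d i) = (\<lambda>x\<in>?X. \<zero>\<^bsub>N\<^esub>)"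
    using mod_homD(1)[OF assms(4)] by (auto simp: compose_def fun_eq_iff)
  ultimately have 0: "(\<lambda>x\<in>?X. \<zero>\<^bsub>N\<^esub>) \<in> ?B" by simp
  have "?B +>\<^bsub>?H\<^esub> ?f \<in> a_rcosets\<^bsub>?H\<^esub> ?B"
    using f by (auto simp: A_RCOSETS_def')
  then have "?B +>\<^bsub>?H\<^esub> ?f = ?B"
    using assms(1) by (simp add: zero_module_def hom_cohomology_def quot_module_def)
  moreover have "(\<lambda>x\<in>?X. \<zero>\<^bsub>N\<^esub>) \<oplus>\<^bsub>?H\<^esub> ?f \<in> ?B +>\<^bsub>?H\<^esub> ?f"
    using 0 by (auto simp: a_r_coset_def')
  moreover have "(\<lambda>x\<in>?X. \<zero>\<^bsub>N\<^esub>) \<oplus>\<^bsub>?H\<^esub> ?f = ?f"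
    using assms(6) mod_homD(1)[OF assms(8)] by (auto simp: hom_module_def fun_eq_iff)
  ultimately have "?f \<in> ?B" by simp
  then obtain g where g: "g \<in> mod_hom R (P i) N" "?f = compose ?X g (d i)"
    by (auto simp: hom_coboundaries_def hom_module_def)
  have "f x = g (d i x)" if "x \<in> ?X" for x
    using fun_cong[OF g(2), of x] that by (simp add: compose_def)
  with g(1) that show thesis by blast
qed

text \<open>\<open>\<gamma>\<close> is constant on the fibres of \<open>e\<close>, so every choice
  of preimages, here by \<open>inv_into\<close>, yields the same well-defined homomorphism.\<close>

lemma mod_hom_factor_surj:
  assumes "module R P" "module R F" "module R N"
    and "e \<in> mod_hom R P N" "e ` carrier P = carrier N" "\<gamma> \<in> mod_hom R P F"
    and "\<And>x. x \<in> carrier P \<Longrightarrow> e x = \<zero>\<^bsub>N\<^esub> \<Longrightarrow> \<gamma> x = \<zero>\<^bsub>F\<^esub>"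
  obtains \<sigma> where "\<sigma> \<in> mod_hom R N F" "\<And>x. x \<in> carrier P \<Longrightarrow> \<sigma> (e x) = \<gamma> x"
proof -
  interpret P: module R P by fact
  interpret N: module R N by fact
  note e = mod_homD[OF assms(4)] and \<gamma> = mod_homD[OF assms(6)]
  have well: "\<gamma> x = \<gamma> y" if "x \<in> carrier P" "y \<in> carrier P" "e x = e y" for x y
  proof -
    have "e (x \<ominus>\<^bsub>P\<^esub> y) = \<zero>\<^bsub>N\<^esub>"
      using that e(1) by (simp add: mod_hom_diff[OF assms(1,3,4)] module_diff_eq_zero_iff[OF assms(3)])
    then have "\<gamma> (x \<ominus>\<^bsub>P\<^esub> y) = \<zero>\<^bsub>F\<^esub>" using that by (intro assms(7)) auto
    then show ?thesis
      using that \<gamma>(1) by (simp add: mod_hom_diff[OF assms(1,2,6)] module_diff_eq_zero_iff[OF assms(2)])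
  qed
  let ?s = "inv_into (carrier P) e"
  have s: "?s y \<in> carrier P" "e (?s y) = y" if "y \<in> carrier N" for y
    using that assms(5) by (auto simp: inv_into_into f_inv_into_f)
  show thesis
  proof
    show "(\<lambda>y. \<gamma> (?s y)) \<in> mod_hom R N F"
    proof (rule mod_homI)
      fix x y assume xy: "x \<in> carrier N" "y \<in> carrier N"
      then have "\<gamma> (?s (x \<oplus>\<^bsub>N\<^esub> y)) = \<gamma> (?s x \<oplus>\<^bsub>P\<^esub> ?s y)" by (intro well) (simp_all add: s e)
      then show "\<gamma> (?s (x \<oplus>\<^bsub>N\<^esub> y)) = \<gamma> (?s x) \<oplus>\<^bsub>F\<^esub> \<gamma> (?s y)" using xy by (simp add: s \<gamma>)
    next
      fix a x assume ax: "a \<in> carrier R" "x \<in> carrier N"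
      then have "\<gamma> (?s (a \<odot>\<^bsub>N\<^esub> x)) = \<gamma> (a \<odot>\<^bsub>P\<^esub> ?s x)" by (intro well) (simp_all add: s e)
      then show "\<gamma> (?s (a \<odot>\<^bsub>N\<^esub> x)) = a \<odot>\<^bsub>F\<^esub> \<gamma> (?s x)" using ax by (simp add: s \<gamma>)
    qed (simp add: s \<gamma>)
    show "\<gamma> (?s (e x)) = \<gamma> x" if "x \<in> carrier P" for x
      using that by (intro well) (simp_all add: s e)
  qed
qed

section \<open>Removing renamings and unfolding the chosen resolutions\<close>

lemma copy_module_inverse_hom:
  assumes "module R M" "inj h"
  shows "inv_into (carrier M) h \<in> mod_hom R (copy_module h M) M"
  by (intro mod_hom_inv_into assms copy_module_hom copy_module_bij inj_on_subset[OF assms(2)] subset_UNIV)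

text \<open>\<open>syzygy\<close> delivers a renamed copy. Undoing the renaming leaves a map from
  \<open>N\<close> onto the syzygy itself together with a right inverse, the form in which
  periodicity is used.\<close>

lemma mod_iso_copyD:
  assumes "module R N" "module R Z" "inj h" "mod_iso R N (copy_module h Z)"
  obtains \<phi> \<psi> where "\<phi> \<in> mod_hom R N Z" "\<psi> \<in> mod_hom R Z N"
    "\<And>z. z \<in> carrier Z \<Longrightarrow> \<phi> (\<psi> z) = z"
proof -
  have inj: "inj_on h (carrier Z)" using assms(3) by (rule inj_on_subset) simp
  obtain \<theta> where \<theta>: "\<theta> \<in> mod_hom R N (copy_module h Z)"
    "bij_betw \<theta> (carrier N) (carrier (copy_module h Z))" using assms(4) by (auto simp: mod_iso_def)
  have h: "h \<in> mod_hom R Z (copy_module h Z)" by (rule copy_module_hom[OF inj])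
  show thesis
  proof
    show "(\<lambda>x. inv_into (carrier Z) h (\<theta> x)) \<in> mod_hom R N Z"
      by (rule mod_hom_comp[OF \<theta>(1) copy_module_inverse_hom[OF assms(2,3)]])
    show "(\<lambda>z. inv_into (carrier N) \<theta> (h z)) \<in> mod_hom R Z N"
      by (rule mod_hom_comp[OF h mod_hom_inv_into[OF assms(1) \<theta>]])
    show "inv_into (carrier Z) h (\<theta> (inv_into (carrier N) \<theta> (h z))) = z" if "z \<in> carrier Z" for z
      using that mod_homD(1)[OF h that] inj \<theta>(2) by (simp add: bij_betw_inv_into_right)
  qed
qed

lemma resolutionD:
  assumes "resolution R P d e M"
  shows "module R (P i)" "d i \<in> mod_hom R (P (Suc i)) (P i)"
    and "e \<in> mod_hom R (P 0) M" "e ` carrier (P 0) = carrier M"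
    and "d 0 ` carrier (P (Suc 0)) = a_kernel (P 0) M e"
    and "d (Suc i) ` carrier (P (Suc (Suc i))) = a_kernel (P (Suc i)) (P i) (d i)"
  using assms by (simp_all add: resolution_def)

text \<open>The \<open>SOME\<close> in \<open>chosen_min_res\<close> is a resolution because one
  exists. The augmentation is not part of the chosen pair and is recovered from the
  existential.\<close>

lemma minimal_free_resolution_chosen:
  assumes "noetherian_ring R" "local_ring R" "module R M" "finitely_generated R M"
  obtains b d e where "chosen_min_res R M = (b, d)" "minimal_free_resolution R b d e M"
proof -
  have "case chosen_min_res R M of (b, d) \<Rightarrow> \<exists>e. minimal_free_resolution R b d e M"
    unfolding chosen_min_res_def
    by (rule someI_ex) (use minimal_free_resolution_exists[OF assms] in auto)
  then show thesis using that by (cases "chosen_min_res R M") auto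
qed

text \<open>Existence is inherited from the minimal free resolution, but the resolution actually
  chosen may be a different one.\<close>

lemma projective_resolution_chosen:
  fixes R :: "('a, 'r) ring_scheme"
  assumes "noetherian_ring R" "local_ring R" "module R M" "finitely_generated R M"
  obtains P d e where "chosen_proj_res R M = (P, d)" "projective_resolution R P d e M"
proof -
  have R: "cring R" using assms(2) by (simp add: local_ring_def)
  obtain b d e where "minimal_free_resolution R b d e M"
    using minimal_free_resolution_exists[OF assms] by blast
  then have "projective_resolution R (\<lambda>i. free_module R {..<b i}) d e M"
    using projective_free_module[OF R local_ring_one_not_zero[OF assms(2)]]
    by (simp add: minimal_free_resolution_def projective_resolution_def)
  then have "\<exists>p :: (nat \<Rightarrow> ('a, nat \<Rightarrow> 'a) module) \<times> (nat \<Rightarrow> (nat \<Rightarrow> 'a) \<Rightarrow> nat \<Rightarrow> 'a).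
      case p of (P, d) \<Rightarrow> \<exists>e. projective_resolution R P d e M"
    by (intro exI[of _ "(\<lambda>i. free_module R {..<b i}, d)"]) auto
  then have "case chosen_proj_res R M of (P, d) \<Rightarrow> \<exists>e. projective_resolution R P d e M"
    unfolding chosen_proj_res_def by (rule someI_ex)
  then show thesis using that by (cases "chosen_proj_res R M") auto
qed

lemma module_diff_zero:
  assumes "module R M" "x \<in> carrier M"
  shows "x \<ominus>\<^bsub>M\<^esub> \<zero>\<^bsub>M\<^esub> = x"
proof -
  interpret M: module R M by fact
  show ?thesis using assms(2) M.M.minus_equality[of "\<zero>\<^bsub>M\<^esub>" "\<zero>\<^bsub>M\<^esub>"] by (simp add: a_minus_def)
qed

lemma direct_sum_left_zero:
  assumes "module R M" "module R N" "y \<in> carrier (direct_sum M N)"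
  shows "\<zero>\<^bsub>direct_sum M N\<^esub> \<oplus>\<^bsub>direct_sum M N\<^esub> y = y"
proof -
  interpret M: module R M by fact
  interpret N: module R N by fact
  show ?thesis using assms(3) by auto
qed

text \<open>The conclusion is a splitting rather than \<open>projective R N\<close> because it still
  has to be moved from the renamed \<open>N\<close> to a module with another element type, and
  \<open>projective\<close> ties its index sets to that type.\<close>

lemma two_periodic_Ext_vanishing_summand:
  fixes N :: "('a, 'b, 'm) module_scheme"
  assumes "noetherian_ring R" "local_ring R" "module R N" "finitely_generated R N"
    and "two_periodic R N"
    and Ext: "zero_module (Ext R 1 N (direct_sum N (regular_module R)))"
      "zero_module (Ext R 2 N (direct_sum N (regular_module R)))"
  obtains n :: nat and \<sigma> \<epsilon> where "\<sigma> \<in> mod_hom R N (free_module R {..<n})"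
    "\<epsilon> \<in> mod_hom R (free_module R {..<n}) N" "\<And>x. x \<in> carrier N \<Longrightarrow> \<epsilon> (\<sigma> x) = x"
proof -
  have R: "cring R" using assms(2) by (simp add: local_ring_def)
  let ?S = "regular_module R"
  have S: "module R ?S" by (rule regular_module_module[OF R])
  obtain b \<delta> \<epsilon> where chosen: "chosen_min_res R N = (b, \<delta>)"
    and min: "minimal_free_resolution R b \<delta> \<epsilon> N"
    using minimal_free_resolution_chosen[OF assms(1-4)] by blast
  let ?F = "\<lambda>i. free_module R {..<b i}"
  have F: "module R (?F i)" for i by (rule free_module_module[OF R])
  from min have res: "resolution R ?F \<delta> \<epsilon> N" by (simp add: minimal_free_resolution_def)
  note \<epsilon> = resolutionD(3,4)[OF res] and \<delta> = resolutionD(2)[OF res]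
    and \<delta>0 = resolutionD(5)[OF res] and \<delta>1 = resolutionD(6)[OF res, of 0]
  obtain P d e where chosenP: "chosen_proj_res R N = (P, d)"
    and proj: "projective_resolution R P d e N"
    using projective_resolution_chosen[OF assms(1-4)] by blast
  from proj have resP: "resolution R P d e N" and "\<And>i. projective R (P i)"
    by (simp_all add: projective_resolution_def)
  note P = resolutionD(1)[OF resP] this(2) and d = resolutionD(2)[OF resP]
    and e = resolutionD(3,4)[OF resP] and d0 = resolutionD(5)[OF resP] and dS = resolutionD(6)[OF resP]
  note d_in = mod_homD(1)[OF d]
  have ed: "e (d 0 x) = \<zero>\<^bsub>N\<^esub>" if "x \<in> carrier (P (Suc 0))" for x
    using that d0 by (auto simp: a_kernel_def')
  have dd: "d i (d (Suc i) x) = \<zero>\<^bsub>P i\<^esub>" if "x \<in> carrier (P (Suc (Suc i)))" for i x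
    using that dS[of i] by (auto simp: a_kernel_def')
  have \<epsilon>\<delta>: "\<epsilon> (\<delta> 0 x) = \<zero>\<^bsub>N\<^esub>" if "x \<in> carrier (?F (Suc 0))" for x
    using that \<delta>0 by (auto simp: a_kernel_def')
  \<comment> \<open>The indices 0 and 1 stand for Ext^1 and Ext^2: cocycles on
    \<open>P (Suc i)\<close> come from maps on \<open>P i\<close>. A cocycle with values in
    \<open>N\<close> or R alone is padded by zero in the other summand.\<close>
  have factor: "\<exists>g\<in>mod_hom R (P i) (direct_sum N ?S). \<forall>x\<in>carrier (P (Suc i)). f x = g (d i x)"
    if f: "f \<in> mod_hom R (P (Suc i)) (direct_sum N ?S)" and i: "i < 2"
      and fd: "\<And>x. x \<in> carrier (P (Suc (Suc i))) \<Longrightarrow> f (d (Suc i) x) = (\<zero>\<^bsub>N\<^esub>, \<zero>\<^bsub>R\<^esub>)" for f i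
  proof -
    have "i = 0 \<or> i = 1" using i by auto
    then have zero: "zero_module (hom_cohomology R P d (direct_sum N ?S) (Suc i))"
      using Ext by (auto simp: Ext_def chosenP numeral_2_eq_2)
    have zero_hom: "(\<lambda>x. \<zero>\<^bsub>direct_sum N ?S\<^esub>) \<in> mod_hom R (P i) (direct_sum N ?S)"
      using direct_sum_pair_hom[OF zero_mod_hom[OF assms(3)] zero_mod_hom[OF S]] by simp
    obtain g where "g \<in> mod_hom R (P i) (direct_sum N ?S)"
      "\<And>x. x \<in> carrier (P (Suc i)) \<Longrightarrow> f x = g (d i x)"
      by (rule hom_cohomology_zero_factor[OF zero P(1) P(1) d d _ zero_hom f])
        (use direct_sum_left_zero[OF assms(3) S] in \<open>simp_all add: fd\<close>)
    then show ?thesis by blast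
  qed

  \<comment> \<open>The second syzygy of \<open>N\<close> before renaming; by exactness it is the
    kernel of \<open>\<delta> 0\<close>.\<close>
  let ?Z = "(?F (Suc 0))\<lparr>carrier := \<delta> (Suc 0) ` carrier (?F (Suc (Suc 0)))\<rparr>"
  have Zsub: "submodule (carrier ?Z) R (?F (Suc 0))"
    using mod_hom_kernel_submodule[OF F F \<delta>[of 0]] \<delta>1 by simp
  have Z: "module R ?Z" using submodule_module[OF F Zsub] by simp
  have ZF: "carrier ?Z \<subseteq> carrier (?F (Suc 0))" by (rule module.submoduleE(1)[OF F Zsub])
  have "mod_iso R N (copy_module (Inr :: _ \<Rightarrow> 'b + _) ?Z)"
    using assms(5) by (simp add: two_periodic_def syzygy_def chosen numeral_2_eq_2)
  then obtain \<phi> \<psi> where \<phi>: "\<phi> \<in> mod_hom R N ?Z" and \<psi>: "\<psi> \<in> mod_hom R ?Z N"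
    and \<phi>\<psi>: "\<And>z. z \<in> carrier ?Z \<Longrightarrow> \<phi> (\<psi> z) = z"
    using mod_iso_copyD[OF assms(3) Z inj_Inr] by blast
  have \<phi>F: "\<phi> \<in> mod_hom R N (?F (Suc 0))" using mod_hom_extend_target[OF \<phi>] ZF by simp
  have \<delta>\<phi>: "\<delta> 0 (\<phi> y) = \<zero>\<^bsub>?F 0\<^esub>" if "y \<in> carrier N" for y
    using mod_homD(1)[OF \<phi> that] \<delta>1 by (auto simp: a_kernel_def')

  \<comment> \<open>The start of a comparison map over the identity of \<open>N\<close>:
    projectivity of \<open>P\<close> and exactness of the minimal resolution provide
    \<open>\<alpha>0\<close> and then \<open>\<alpha>1\<close>.\<close>
  obtain \<alpha>0 where \<alpha>0: "\<alpha>0 \<in> mod_hom R (P 0) (?F 0)"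
    and \<epsilon>\<alpha>0: "\<And>x. x \<in> carrier (P 0) \<Longrightarrow> \<epsilon> (\<alpha>0 x) = e x"
    using projective_lift[OF P(2) F assms(3) \<epsilon>(1) e(1)] e(2) \<epsilon>(2) by blast
  have \<alpha>0d: "(\<lambda>x. \<alpha>0 (d 0 x)) \<in> mod_hom R (P (Suc 0)) (?F 0)" by (rule mod_hom_comp[OF d \<alpha>0])
  have im: "(\<lambda>x. \<alpha>0 (d 0 x)) ` carrier (P (Suc 0)) \<subseteq> \<delta> 0 ` carrier (?F (Suc 0))"
    unfolding \<delta>0 using mod_homD(1)[OF \<alpha>0d] by (auto simp: a_kernel_def' \<epsilon>\<alpha>0 d_in ed)
  obtain \<alpha>1 where \<alpha>1: "\<alpha>1 \<in> mod_hom R (P (Suc 0)) (?F (Suc 0))"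
    and \<delta>\<alpha>1: "\<And>x. x \<in> carrier (P (Suc 0)) \<Longrightarrow> \<delta> 0 (\<alpha>1 x) = \<alpha>0 (d 0 x)"
    using projective_lift[OF P(2) F F \<delta>[of 0] \<alpha>0d im] by blast

  have \<alpha>1d: "(\<lambda>x. \<alpha>1 (d (Suc 0) x)) \<in> mod_hom R (P (Suc (Suc 0))) (?F (Suc 0))"
    by (rule mod_hom_comp[OF d \<alpha>1])
  \<comment> \<open>Applying \<open>\<delta> 0\<close> gives \<open>\<alpha>0\<close> of a double
    differential, which is zero. So this is a 2-cocycle with values in the second syzygy, and
    \<open>\<psi>\<close> carries it to \<open>N\<close>.\<close>
  have \<alpha>1d_Z: "\<alpha>1 (d (Suc 0) x) \<in> carrier ?Z" if "x \<in> carrier (P (Suc (Suc 0)))" for x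
    using that mod_homD(1)[OF \<alpha>1d] mod_hom_zero[OF P(1) F \<alpha>0]
    by (simp add: \<delta>1 a_kernel_def' \<delta>\<alpha>1 d_in dd)
  have \<alpha>1dZ: "(\<lambda>x. \<alpha>1 (d (Suc 0) x)) \<in> mod_hom R (P (Suc (Suc 0))) ?Z"
    using \<alpha>1d_Z by (intro mod_hom_restrict_target[OF \<alpha>1d]) auto
  have f: "(\<lambda>x. (\<psi> (\<alpha>1 (d (Suc 0) x)), \<zero>\<^bsub>?S\<^esub>)) \<in> mod_hom R (P (Suc (Suc 0))) (direct_sum N ?S)"
    by (rule direct_sum_pair_hom[OF mod_hom_comp[OF \<alpha>1dZ \<psi>] zero_mod_hom[OF S]])
  have "\<psi> (\<alpha>1 (d (Suc 0) (d (Suc (Suc 0)) x))) = \<zero>\<^bsub>N\<^esub>" if "x \<in> carrier (P (Suc (Suc (Suc 0))))" for x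
    using that mod_hom_zero[OF P(1) F \<alpha>1] mod_hom_zero[OF Z assms(3) \<psi>] by (simp add: dd)
  then obtain g' where g': "g' \<in> mod_hom R (P (Suc 0)) (direct_sum N ?S)"
    "\<And>x. x \<in> carrier (P (Suc (Suc 0))) \<Longrightarrow> (\<psi> (\<alpha>1 (d (Suc 0) x)), \<zero>\<^bsub>?S\<^esub>) = g' (d (Suc 0) x)"
    using factor[OF f] by auto
  define g where "g x = fst (g' x)" for x
  have g: "g \<in> mod_hom R (P (Suc 0)) N"
    unfolding g_def by (rule mod_hom_comp[OF g'(1) direct_sum_fst_hom])
  have gd: "g (d (Suc 0) x) = \<psi> (\<alpha>1 (d (Suc 0) x))" if "x \<in> carrier (P (Suc (Suc 0)))" for x
    using g'(2)[OF that, symmetric] by (simp add: g_def)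

  \<comment> \<open>On the image of \<open>d (Suc 0)\<close> the two terms agree because
    \<open>\<phi>\<close> undoes \<open>\<psi>\<close>; hence \<open>\<beta>\<close> is a
    1-cocycle.\<close>
  define \<beta> where "\<beta> x = \<alpha>1 x \<ominus>\<^bsub>?F (Suc 0)\<^esub> \<phi> (g x)" for x
  have \<phi>g: "(\<lambda>x. \<phi> (g x)) \<in> mod_hom R (P (Suc 0)) (?F (Suc 0))" by (rule mod_hom_comp[OF g \<phi>F])
  have \<beta>: "\<beta> \<in> mod_hom R (P (Suc 0)) (?F (Suc 0))"
    unfolding \<beta>_def by (rule mod_hom_subtract[OF P(1) F \<alpha>1 \<phi>g])
  have \<beta>d: "\<beta> (d (Suc 0) x) = \<zero>\<^bsub>?F (Suc 0)\<^esub>" if "x \<in> carrier (P (Suc (Suc 0)))" for x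
    using that mod_homD(1)[OF \<alpha>1d that]
    by (simp add: \<beta>_def gd \<phi>\<psi>[OF \<alpha>1d_Z] module_diff_eq_zero_iff[OF F])
  \<comment> \<open>The target of \<open>\<beta>\<close> is a finite power of R, so Ext^1 with
    coefficients in R is applied to each coordinate.\<close>
  have "\<exists>h\<in>mod_hom R (P 0) ?S. \<forall>x\<in>carrier (P (Suc 0)). \<beta> x j = h (d 0 x)" if j: "j < b (Suc 0)" for j
  proof -
    have \<beta>j: "(\<lambda>x. \<beta> x j) \<in> mod_hom R (P (Suc 0)) ?S"
      using j by (intro mod_hom_comp[OF \<beta> free_module_component_hom]) simp
    have "(\<zero>\<^bsub>N\<^esub>, \<beta> (d (Suc 0) x) j) = (\<zero>\<^bsub>N\<^esub>, \<zero>\<^bsub>R\<^esub>)" if "x \<in> carrier (P (Suc (Suc 0)))" for x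
      using j by (simp add: \<beta>d[OF that] free_module_simps)
    then obtain h where h: "h \<in> mod_hom R (P 0) (direct_sum N ?S)"
      "\<And>x. x \<in> carrier (P (Suc 0)) \<Longrightarrow> (\<zero>\<^bsub>N\<^esub>, \<beta> x j) = h (d 0 x)"
      using factor[OF direct_sum_pair_hom[OF zero_mod_hom[OF assms(3)] \<beta>j]] by auto
    show ?thesis
      using mod_hom_comp[OF h(1) direct_sum_snd_hom] h(2)[symmetric]
      by (intro bexI[of _ "\<lambda>x. snd (h x)"]) simp_all
  qed
  then obtain h' where h': "\<And>j. j < b (Suc 0) \<Longrightarrow> h' j \<in> mod_hom R (P 0) ?S"
    "\<And>j x. j < b (Suc 0) \<Longrightarrow> x \<in> carrier (P (Suc 0)) \<Longrightarrow> \<beta> x j = h' j (d 0 x)" by metis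
  define h where "h x = (\<lambda>j\<in>{..<b (Suc 0)}. h' j x)" for x
  have h: "h \<in> mod_hom R (P 0) (?F (Suc 0))"
  proof (rule mod_homI)
    fix x assume "x \<in> carrier (P 0)"
    then show "h x \<in> carrier (?F (Suc 0))" unfolding h_def
      using mod_homD(1)[OF h'(1)] by (intro free_module_carrierI) auto
  qed (auto simp: h_def free_module_simps fun_eq_iff mod_homD(2,3)[OF h'(1)])
  have hd: "h (d 0 x) = \<beta> x" if "x \<in> carrier (P (Suc 0))" for x
    using free_module_carrierD(1)[OF mod_homD(1)[OF \<beta> that]] h'(2)[OF _ that]
    by (auto simp: h_def fun_eq_iff extensional_def)

  \<comment> \<open>This correction makes \<open>\<gamma>\<close> vanish on the image of
    \<open>d 0\<close>, yet \<open>\<epsilon>\<close> does not see it because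
    \<open>\<epsilon>\<close> kills the image of \<open>\<delta> 0\<close>. So
    \<open>\<gamma>\<close> descends to \<open>N\<close> and still covers the identity.\<close>
  define \<gamma> where "\<gamma> x = \<alpha>0 x \<ominus>\<^bsub>?F 0\<^esub> \<delta> 0 (h x)" for x
  have \<delta>h: "(\<lambda>x. \<delta> 0 (h x)) \<in> mod_hom R (P 0) (?F 0)" by (rule mod_hom_comp[OF h \<delta>])
  have \<gamma>: "\<gamma> \<in> mod_hom R (P 0) (?F 0)"
    unfolding \<gamma>_def by (rule mod_hom_subtract[OF P(1) F \<alpha>0 \<delta>h])
  have "\<gamma> (d 0 x) = \<zero>\<^bsub>?F 0\<^esub>" if x: "x \<in> carrier (P (Suc 0))" for x
  proof -
    \<comment> \<open>\<open>\<phi>\<close> takes values in the kernel of \<open>\<delta> 0\<close>,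
      so passing from \<open>\<alpha>1\<close> to \<open>\<beta>\<close> has not changed the image
      under \<open>\<delta> 0\<close>.\<close>
    have "\<delta> 0 (h (d 0 x)) = \<alpha>0 (d 0 x) \<ominus>\<^bsub>?F 0\<^esub> \<zero>\<^bsub>?F 0\<^esub>"
      unfolding hd[OF x] \<beta>_def
      by (subst mod_hom_diff[OF F F \<delta> mod_homD(1)[OF \<alpha>1 x] mod_homD(1)[OF \<phi>g x]])
        (simp add: \<delta>\<alpha>1[OF x] \<delta>\<phi>[OF mod_homD(1)[OF g x]])
    then show ?thesis
      using mod_homD(1)[OF \<alpha>0d x]
      by (simp add: \<gamma>_def module_diff_zero[OF F] module_diff_eq_zero_iff[OF F])
  qed
  then have "\<gamma> x = \<zero>\<^bsub>?F 0\<^esub>" if "x \<in> carrier (P 0)" "e x = \<zero>\<^bsub>N\<^esub>" for x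
  proof -
    have "x \<in> d 0 ` carrier (P (Suc 0))" using that d0 by (simp add: a_kernel_def')
    then show ?thesis using \<open>\<And>x. x \<in> carrier (P (Suc 0)) \<Longrightarrow> \<gamma> (d 0 x) = \<zero>\<^bsub>?F 0\<^esub>\<close> by auto
  qed
  then obtain \<sigma> where \<sigma>: "\<sigma> \<in> mod_hom R N (?F 0)" "\<And>x. x \<in> carrier (P 0) \<Longrightarrow> \<sigma> (e x) = \<gamma> x"
    using mod_hom_factor_surj[OF P(1) F assms(3) e \<gamma>] by blast
  have "\<epsilon> (\<sigma> y) = y" if "y \<in> carrier N" for y
  proof -
    from that e(2) obtain x where x: "x \<in> carrier (P 0)" "y = e x" by auto
    have "\<epsilon> (\<gamma> x) = e x \<ominus>\<^bsub>N\<^esub> \<zero>\<^bsub>N\<^esub>"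
      unfolding \<gamma>_def
      by (subst mod_hom_diff[OF F assms(3) \<epsilon>(1) mod_homD(1)[OF \<alpha>0 x(1)] mod_homD(1)[OF \<delta>h x(1)]])
        (simp add: \<epsilon>\<alpha>0[OF x(1)] \<epsilon>\<delta>[OF mod_homD(1)[OF h x(1)]])
    then show ?thesis using x that by (simp add: \<sigma>(2) module_diff_zero[OF assms(3)])
  qed
  with \<sigma>(1) \<epsilon>(1) that show thesis by blast
qed

section \<open>Bounds on the projective dimension\<close>

lemma proj_dim_leI:
  fixes P :: "nat \<Rightarrow> ('a, nat \<Rightarrow> 'a) module"
  assumes "projective_resolution R P d e M" "\<And>i. n < i \<Longrightarrow> zero_module (P i)"
  shows "proj_dim R M \<le> enat n"
proof -
  have "\<exists>(P :: nat \<Rightarrow> ('a, nat \<Rightarrow> 'a) module) d e.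
      projective_resolution R P d e M \<and> (\<forall>i>n. zero_module (P i))"
    using assms by (intro exI[of _ P] exI[of _ d] exI[of _ e]) simp
  then show ?thesis unfolding proj_dim_def by (intro Inf_lower CollectI exI[of _ n]) simp
qed

lemma zero_free_module: "zero_module (free_module R {})"
  by (auto simp: zero_module_def free_module_def)

text \<open>\<open>proj_dim\<close> admits only resolving modules with elements in
  \<open>nat \<Rightarrow> 'a\<close>, while \<open>M\<close> has an arbitrary element type. The
  image of \<open>u\<close> in R^n is an isomorphic copy of the right type, and \<open>v\<close>
  restricted to it is the augmentation of a resolution of length 0.\<close>

lemma proj_dim_summand_free:
  fixes n :: nat and M :: "('a, 'b, 'm) module_scheme"
  assumes "module R M" "\<one>\<^bsub>R\<^esub> \<noteq> \<zero>\<^bsub>R\<^esub>"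
    and "u \<in> mod_hom R M (free_module R {..<n})" "v \<in> mod_hom R (free_module R {..<n}) M"
    and "\<And>x. x \<in> carrier M \<Longrightarrow> v (u x) = x"
  shows "proj_dim R M \<le> enat 0"
proof -
  interpret M: module R M by fact
  note R = M.R.is_cring
  let ?F = "free_module R {..<n}" and ?O = "free_module R ({} :: nat set)"
  have F: "module R ?F" and O: "module R ?O" by (rule free_module_module[OF R])+
  have U: "submodule (u ` carrier M) R ?F"
    by (rule mod_hom_image_submodule[OF assms(1) F assms(3) M.carrier_is_submodule])
  let ?U = "?F\<lparr>carrier := u ` carrier M\<rparr>"
  have UM: "module R ?U" by (rule submodule_module[OF F U])
  have UF: "u ` carrier M \<subseteq> carrier ?F" by (rule module.submoduleE(1)[OF F U])
  define P where "P i = (if i = 0 then ?U else ?O)" for i :: nat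
  define d where "d i x = \<zero>\<^bsub>P i\<^esub>" for i :: nat and x :: "nat \<Rightarrow> 'a"
  have u: "u \<in> mod_hom R M ?U" by (rule mod_hom_restrict_target[OF assms(3)]) simp
  have incl: "(\<lambda>x. x) \<in> mod_hom R ?U ?F" using UF by (auto simp: mod_hom_def)
  have v: "v \<in> mod_hom R ?U M" by (rule mod_hom_restrict_source[OF assms(4) UF])
  \<comment> \<open>The composite of \<open>v\<close> and \<open>u\<close> retracts R^n onto the
    image of \<open>u\<close>.\<close>
  have projU: "projective R ?U"
    by (rule projective_summand[OF UM assms(2) incl mod_hom_comp[OF assms(4) u]]) (auto simp: assms(5))
  have P: "module R (P i)" for i using UM O by (simp add: P_def)
  have proj: "projective R (P i)" for i
    using projU projective_free_module[OF R assms(2), of 0] by (simp add: P_def)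
  have z: "carrier ?O = {\<zero>\<^bsub>?O\<^esub>}" using zero_free_module by (simp add: zero_module_def)
  have v0: "a_kernel ?U M v = {\<zero>\<^bsub>?U\<^esub>}"
  proof
    show "a_kernel ?U M v \<subseteq> {\<zero>\<^bsub>?U\<^esub>}"
      using mod_hom_zero[OF assms(1) UM u] by (auto simp: a_kernel_def' assms(5))
    have "u \<zero>\<^bsub>M\<^esub> \<in> a_kernel ?U M v" by (simp add: a_kernel_def' assms(5))
    then show "{\<zero>\<^bsub>?U\<^esub>} \<subseteq> a_kernel ?U M v" using mod_hom_zero[OF assms(1) UM u] by simp
  qed
  have "projective_resolution R P d v M"
    unfolding projective_resolution_def resolution_def
  proof (intro conjI allI)
    fix i
    show "d i \<in> mod_hom R (P (Suc i)) (P i)"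
      using zero_mod_hom[OF P] by (simp add: d_def[abs_def])
    show "v \<in> mod_hom R (P 0) M" using v by (simp add: P_def)
    show "v ` carrier (P 0) = carrier M" using assms(5) by (force simp: P_def)
    show "d 0 ` carrier (P (Suc 0)) = a_kernel (P 0) M v"
      using v0 z by (simp add: P_def d_def)
    show "d (Suc i) ` carrier (P (Suc (Suc i))) = a_kernel (P (Suc i)) (P i) (d i)"
      using z by (auto simp: P_def d_def a_kernel_def')
  qed (rule P proj)+
  then show ?thesis by (rule proj_dim_leI) (simp add: P_def zero_free_module)
qed

text \<open>The resolution is cut at the image of \<open>d k\<close>, which is placed in degree
  \<open>Suc k\<close> with its inclusion into R^n as differential. Since the zeroth syzygy is
  \<open>M\<close>, this image is the syzygy of index \<open>Suc k\<close>, which gives the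
  bound.\<close>

lemma proj_dim_projective_syzygy:
  fixes M :: "('a, 'b, 'm) module_scheme" and b :: "nat \<Rightarrow> nat"
  assumes "cring R" "\<one>\<^bsub>R\<^esub> \<noteq> \<zero>\<^bsub>R\<^esub>" "resolution R (\<lambda>i. free_module R {..<b i}) d e M"
    and "projective R ((free_module R {..<b k})\<lparr>carrier := d k ` carrier (free_module R {..<b (Suc k)})\<rparr>)"
  shows "proj_dim R M \<le> enat (Suc k)"
proof -
  let ?F = "\<lambda>i. free_module R {..<b i}" and ?O = "free_module R ({} :: nat set)"
  let ?Z = "(?F k)\<lparr>carrier := d k ` carrier (?F (Suc k))\<rparr>"
  have F: "module R (free_module R {..<n})" for n :: nat by (rule free_module_module[OF assms(1)])
  have Z: "module R ?Z" using assms(4) by (simp add: projective_def)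
  note d = resolutionD(2)[OF assms(3)] and e = resolutionD(3,4)[OF assms(3)]
    and d0 = resolutionD(5)[OF assms(3)] and dS = resolutionD(6)[OF assms(3)]
  have ZF: "carrier ?Z \<subseteq> carrier (?F k)" using mod_homD(1)[OF d[of k]] by auto
  define P where "P i = (if i \<le> k then ?F i else if i = Suc k then ?Z else ?O)" for i
  define d' where "d' i x = (if i < k then d i x else if i = k then x else \<zero>\<^bsub>P i\<^esub>)" for i x
  have P: "module R (P i)" for i using Z F F[of 0] by (simp add: P_def)
  have proj: "projective R (P i)" for i
    using assms(4) projective_free_module[OF assms(1,2)] projective_free_module[OF assms(1,2), of 0]
    by (simp add: P_def)
  have z: "carrier ?O = {\<zero>\<^bsub>?O\<^esub>}" using zero_free_module by (simp add: zero_module_def)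
  have incl: "(\<lambda>x. x) \<in> mod_hom R ?Z (?F k)" using ZF by (auto simp: mod_hom_def)
  \<comment> \<open>Needed for exactness in degree \<open>Suc k\<close>: the inclusion has kernel
    zero, which must equal the image of the zero module above it.\<close>
  have zero_mem: "\<zero>\<^bsub>?F k\<^esub> \<in> carrier ?Z"
  proof -
    interpret Z: module R ?Z by (rule Z)
    show ?thesis using Z.M.zero_closed by simp
  qed
  have "projective_resolution R P d' e M"
    unfolding projective_resolution_def resolution_def
  proof (intro conjI allI)
    fix i
    consider "i < k" | "i = k" | "i = Suc k" | "i > Suc k" by linarith
    note c = this
    show "d' i \<in> mod_hom R (P (Suc i)) (P i)"
      using c
    proof cases
      case 1
      then show ?thesis using d[of i] by (simp add: P_def d'_def[abs_def])
    next
      case 2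
      then show ?thesis using incl by (simp add: P_def d'_def[abs_def])
    qed (use zero_mod_hom[OF P] in \<open>simp_all add: d'_def[abs_def]\<close>)
    show "e \<in> mod_hom R (P 0) M" "e ` carrier (P 0) = carrier M" using e by (simp_all add: P_def)
    show "d' 0 ` carrier (P (Suc 0)) = a_kernel (P 0) M e"
      using d0 by (cases "k = 0") (simp_all add: P_def d'_def a_kernel_def')
    show "d' (Suc i) ` carrier (P (Suc (Suc i))) = a_kernel (P (Suc i)) (P i) (d' i)"
      using c
    proof cases
      case 1
      then show ?thesis using dS[of i]
        by (cases "Suc i = k") (simp_all add: P_def d'_def a_kernel_def' image_def)
    next
      case 2
      then show ?thesis using z zero_mem by (auto simp: P_def d'_def a_kernel_def')
    qed (use z in \<open>auto simp: P_def d'_def a_kernel_def'\<close>)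
  qed (rule P proj)+
  then show ?thesis by (rule proj_dim_leI) (simp add: P_def zero_free_module)
qed

theorem proposition13:
  fixes R :: "('a, 'r) ring_scheme"
    and M :: "('a, 'b, 'm) module_scheme"
    and N :: "('a, 'b + (nat \<Rightarrow> 'a)) module"
    and s :: nat
  assumes "noetherian_ring R"
    and "local_ring R"
    and "module R M"
    and "finitely_generated R M"
    and "eventually_two_periodic R M"
    and "s = (LEAST t. two_periodic R (syzygy R t M))"
    and "N = syzygy R s M"
    and "\<And>i. i \<ge> 1 \<Longrightarrow> zero_module (Ext R i N (direct_sum N (regular_module R)))"
  shows "proj_dim R M \<le> enat s"
proof -
  have R: "cring R" using assms(2) by (simp add: local_ring_def)
  note one = local_ring_one_not_zero[OF assms(2)]
  have tp: "two_periodic R N"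
    using assms(5) LeastI_ex[of "\<lambda>t. two_periodic R (syzygy R t M)"]
    by (simp add: eventually_two_periodic_def assms(6,7))
  show ?thesis
  \<comment> \<open>The zeroth syzygy is \<open>M\<close> with its own element type and needs a copy
    in R^n; a positive syzygy is a submodule of R^n already, and the resolution of \<open>M\<close>
    is cut there.\<close>
  proof (cases s)
    case 0
    have N: "N = copy_module Inl M" by (simp add: assms(7) 0 syzygy_def)
    have Nm: "module R N" unfolding N by (rule copy_module_module[OF assms(3)]) simp
    have inl: "Inl \<in> mod_hom R M N" unfolding N by (rule copy_module_hom) simp
    have Nfg: "finitely_generated R N"
      by (rule finitely_generated_image[OF assms(3) Nm inl _ assms(4)]) (simp add: N)
    obtain n :: nat and \<sigma> \<epsilon> where *: "\<sigma> \<in> mod_hom R N (free_module R {..<n})"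
      "\<epsilon> \<in> mod_hom R (free_module R {..<n}) N" "\<And>x. x \<in> carrier N \<Longrightarrow> \<epsilon> (\<sigma> x) = x"
      by (rule two_periodic_Ext_vanishing_summand[OF assms(1,2) Nm Nfg tp assms(8) assms(8)]) auto
    \<comment> \<open>Undoing the renaming makes \<open>M\<close> itself a summand of R^n.\<close>
    have "inv_into (carrier M) Inl \<in> mod_hom R N M"
      unfolding N by (rule copy_module_inverse_hom[OF assms(3)]) simp
    from proj_dim_summand_free[OF assms(3) one mod_hom_comp[OF inl *(1)] mod_hom_comp[OF *(2) this]]
    show ?thesis using *(3) by (simp add: 0 N)
  next
    case (Suc k)
    obtain b d e where chosen: "chosen_min_res R M = (b, d)"
      and min: "minimal_free_resolution R b d e M"
      using minimal_free_resolution_chosen[OF assms(1-4)] by blast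
    let ?F = "\<lambda>i. free_module R {..<b i}"
    have F: "module R (?F i)" for i by (rule free_module_module[OF R])
    let ?Z = "(?F k)\<lparr>carrier := d k ` carrier (?F (Suc k))\<rparr>"
    from min have res: "resolution R ?F d e M" by (simp add: minimal_free_resolution_def)
    then have d: "d k \<in> mod_hom R (?F (Suc k)) (?F k)" by (simp add: resolution_def)
    have Zm: "module R ?Z"
      by (intro submodule_module F mod_hom_image_submodule[OF F F d] module.carrier_is_submodule)
    have N: "N = copy_module Inr ?Z" by (simp add: assms(7) Suc syzygy_def chosen)
    have Nm: "module R N" unfolding N by (rule copy_module_module[OF Zm]) simp
    have inr: "Inr \<in> mod_hom R ?Z N" unfolding N by (rule copy_module_hom) simp
    have Zfg: "finitely_generated R ?Z"
      by (rule finitely_generated_image[OF F Zm mod_hom_restrict_target[OF d] _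
            free_module_finitely_generated[OF R]]) auto
    have Nfg: "finitely_generated R N"
      by (rule finitely_generated_image[OF Zm Nm inr _ Zfg]) (simp add: N)
    obtain n :: nat and \<sigma> \<epsilon> where *: "\<sigma> \<in> mod_hom R N (free_module R {..<n})"
      "\<epsilon> \<in> mod_hom R (free_module R {..<n}) N" "\<And>x. x \<in> carrier N \<Longrightarrow> \<epsilon> (\<sigma> x) = x"
      by (rule two_periodic_Ext_vanishing_summand[OF assms(1,2) Nm Nfg tp assms(8) assms(8)]) auto
    have "inv_into (carrier ?Z) Inr \<in> mod_hom R N ?Z"
      unfolding N by (rule copy_module_inverse_hom[OF Zm]) simp
    from projective_summand[OF Zm one mod_hom_comp[OF inr *(1)] mod_hom_comp[OF *(2) this]]
    have "projective R ?Z" using *(3) by (simp add: N)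
    then show ?thesis unfolding Suc by (rule proj_dim_projective_syzygy[OF R one res])
  qed
qed

end
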